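(* Let $K$ be a field and let $G$ be a finite simple graph on the vertex set $[n]$ such that $G$ does not contain any induced cycle of length $4$, $5$ or $6$. Then $G$ is rigid if and only if each edge of $G$ is a branch and each vertex of a $3$-cycle of $G$ belongs to a leaf.
   Context: Let $S=K[x_1,\ldots,x_n]$. The edge ideal $I(G)\subseteq S$ is generated by the products $x_ix_j$ with $\{i,j\}\in E(G)$. For an ideal $I\subseteq S$, $T^1(S/I)$ is the cokernel of $\delta^*:\mathrm{Der}_K(S)\to\mathrm{Hom}_S(I,S/I)$, $\delta^*(\partial)(f)=\partial f+I$. The graph $G$ is called rigid if $T^1(S/I(G))=0$. A vertex is free if it has degree $1$. An edge is a leaf if it contains a free vertex. An edge $e$ of $G$ is a branch if there exists a leaf $e'\neq e$ with $e\cap e'\neq\emptyset$. An induced cycle of $G$ is a cycle which is an induced subgraph of $G$. *)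

theory Defs
  imports "HOL-Algebra.QuotRing" "HOL-Library.Poly_Mapping" "HOL-Library.FuncSet"
begin

text \<open>The polynomial ring $K[x_v : v \in V]$, where $V$ is the set of all elements of the
  type \<open>'v\<close>: a polynomial maps exponent vectors to coefficients, and the product of
  \<open>\<Rightarrow>\<^sub>0\<close> is convolution.\<close>

type_synonym ('v, 'k) mpoly = "('v \<Rightarrow>\<^sub>0 nat) \<Rightarrow>\<^sub>0 'k"

definition Const :: "'k::field \<Rightarrow> ('v, 'k) mpoly" where
  "Const c = Poly_Mapping.single 0 c"

definition Var :: "'v \<Rightarrow> ('v, 'k::field) mpoly" where
  "Var v = Poly_Mapping.single (Poly_Mapping.single v 1) 1"

definition poly_ring :: "('v, 'k::field) mpoly ring" where
  "poly_ring = \<lparr>carrier = UNIV, mult = (*), one = 1, zero = 0, add = (+)\<rparr>"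

definition Der :: "(('v, 'k::field) mpoly \<Rightarrow> ('v, 'k) mpoly) set" where
  "Der = {D. (\<forall>f g. D (f + g) = D f + D g)
           \<and> (\<forall>c f. D (Const c * f) = Const c * D f)
           \<and> (\<forall>f g. D (f * g) = f * D g + D f * g)}"

text \<open>The group $\mathrm{Hom}_S(I, S/I)$ under pointwise addition, written as a multiplicative
  record. Homomorphisms are restricted to \<open>I\<close>, so that equal maps on \<open>I\<close> are equal functions.
  An element \<open>s\<close> of \<open>S\<close> acts on \<open>S/I\<close> as multiplication by its residue class \<open>I +> s\<close>.\<close>

definition Hom_quot :: "('v, 'k::field) mpoly set \<Rightarrow> (('v, 'k) mpoly \<Rightarrow> ('v, 'k) mpoly set) monoid"
  where
  "Hom_quot I = \<lparr>
     carrier = {\<phi> \<in> I \<rightarrow>\<^sub>E carrier (poly_ring Quot I).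
       (\<forall>f\<in>I. \<forall>g\<in>I. \<phi> (f + g) = \<phi> f \<oplus>\<^bsub>poly_ring Quot I\<^esub> \<phi> g)
       \<and> (\<forall>s. \<forall>f\<in>I. \<phi> (s * f) = (I +>\<^bsub>poly_ring\<^esub> s) \<otimes>\<^bsub>poly_ring Quot I\<^esub> \<phi> f)},
     mult = (\<lambda>\<phi> \<psi>. \<lambda>f\<in>I. \<phi> f \<oplus>\<^bsub>poly_ring Quot I\<^esub> \<psi> f),
     one = (\<lambda>f\<in>I. \<zero>\<^bsub>poly_ring Quot I\<^esub>)\<rparr>"

definition delta_star ::
  "('v, 'k::field) mpoly set \<Rightarrow> (('v, 'k) mpoly \<Rightarrow> ('v, 'k) mpoly) \<Rightarrow> ('v, 'k) mpoly \<Rightarrow> ('v, 'k) mpoly set"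
  where "delta_star I D = (\<lambda>f\<in>I. I +>\<^bsub>poly_ring\<^esub> D f)"

text \<open>Only the additive group underlying the \<open>S\<close>-module $T^1(S/I)$ is recorded; this determines
  whether the module vanishes.\<close>

definition T1 :: "('v, 'k::field) mpoly set \<Rightarrow> (('v, 'k) mpoly \<Rightarrow> ('v, 'k) mpoly set) set monoid"
  where "T1 I = Hom_quot I Mod (delta_star I ` Der)"

text \<open>A graph is given by its set of edges; its vertices are all elements of the type \<open>'v\<close>.\<close>

definition simple_graph :: "'v::finite set set \<Rightarrow> bool" where
  "simple_graph E \<longleftrightarrow> (\<forall>e\<in>E. card e = 2)"

definition edge_ideal :: "'v::finite set set \<Rightarrow> ('v, 'k::field) mpoly set" where
  "edge_ideal E = Idl\<^bsub>poly_ring\<^esub> {Var i * Var j | i j. {i, j} \<in> E}"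

text \<open>The field enters only through its type, so \<open>rigid TYPE('k) E\<close> is rigidity over \<open>'k\<close>.\<close>

definition rigid :: "'k::field itself \<Rightarrow> 'v::finite set set \<Rightarrow> bool" where
  "rigid K E \<longleftrightarrow>
     carrier (T1 (edge_ideal E :: ('v, 'k) mpoly set))
       = {\<one>\<^bsub>T1 (edge_ideal E :: ('v, 'k) mpoly set)\<^esub>}"

definition degree :: "'v set set \<Rightarrow> 'v \<Rightarrow> nat" where
  "degree E v = card {e \<in> E. v \<in> e}"

definition free_vertex :: "'v set set \<Rightarrow> 'v \<Rightarrow> bool" where
  "free_vertex E v \<longleftrightarrow> degree E v = 1"

definition leaf :: "'v set set \<Rightarrow> 'v set \<Rightarrow> bool" where
  "leaf E e \<longleftrightarrow> e \<in> E \<and> (\<exists>v\<in>e. free_vertex E v)"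

definition branch :: "'v set set \<Rightarrow> 'v set \<Rightarrow> bool" where
  "branch E e \<longleftrightarrow> e \<in> E \<and> (\<exists>e'. leaf E e' \<and> e' \<noteq> e \<and> e \<inter> e' \<noteq> {})"

text \<open>A cycle is the list of its distinct vertices in cyclic order.\<close>

definition cycle_edges :: "'v list \<Rightarrow> 'v set set" where
  "cycle_edges vs = {{vs ! i, vs ! (Suc i mod length vs)} | i. i < length vs}"

definition cycle :: "'v set set \<Rightarrow> 'v list \<Rightarrow> bool" where
  "cycle E vs \<longleftrightarrow> 3 \<le> length vs \<and> distinct vs \<and> cycle_edges vs \<subseteq> E"

definition induced_cycle :: "'v set set \<Rightarrow> 'v list \<Rightarrow> bool" where
  "induced_cycle E vs \<longleftrightarrow> cycle E vs \<and> {e \<in> E. e \<subseteq> set vs} = cycle_edges vs"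

text \<open>The quotient defining \<open>T1\<close> is meaningful: \<open>Hom_quot I\<close> is an abelian group, and
  \<open>delta_star I\<close> maps the derivations onto a subgroup of it.\<close>

lemma poly_ring_simps [simp]:
  "carrier poly_ring = UNIV" "x \<otimes>\<^bsub>poly_ring\<^esub> y = x * y" "x \<oplus>\<^bsub>poly_ring\<^esub> y = x + y"
  "\<zero>\<^bsub>poly_ring\<^esub> = 0" "\<one>\<^bsub>poly_ring\<^esub> = 1"
  by (simp_all add: poly_ring_def)

lemma cring_poly_ring: "cring (poly_ring :: ('v, 'k::field) mpoly ring)"
proof (rule cringI)
  show "abelian_group (poly_ring :: ('v, 'k) mpoly ring)"
  proof (rule abelian_groupI)
    fix x :: "('v, 'k) mpoly" assume "x \<in> carrier poly_ring"
    show "\<exists>y\<in>carrier poly_ring. y \<oplus>\<^bsub>poly_ring\<^esub> x = \<zero>\<^bsub>poly_ring\<^esub>"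
      by (rule bexI[of _ "- x"]) simp_all
  qed (simp_all add: algebra_simps)
  show "comm_monoid (poly_ring :: ('v, 'k) mpoly ring)"
    by (rule comm_monoidI) (simp_all add: algebra_simps)
qed (simp add: algebra_simps)

lemma ideal_edge_ideal: "ideal (edge_ideal E :: ('v::finite, 'k::field) mpoly set) poly_ring"
  unfolding edge_ideal_def
  by (rule ring.genideal_ideal) (simp_all add: cring.axioms(1) cring_poly_ring)

lemma ideal_closed:
  assumes "ideal I (poly_ring :: ('v, 'k::field) mpoly ring)" "f \<in> I"
  shows "g \<in> I \<Longrightarrow> f + g \<in> I" and "s * f \<in> I"
  using assms ideal.I_l_closed[OF assms, of s]
    additive_subgroup.a_closed[OF ideal.axioms(1)[OF assms(1)], of f g]
  by simp_all

lemma comm_group_Hom_quot: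
  assumes I: "ideal I (poly_ring :: ('v, 'k::field) mpoly ring)"
  shows "comm_group (Hom_quot I)"
proof -
  interpret Q: cring "poly_ring Quot I"
    by (rule ideal.quotient_is_cring[OF I cring_poly_ring])
  have proj: "I +>\<^bsub>poly_ring\<^esub> s \<in> carrier (poly_ring Quot I)" for s
    using ideal.rcos_ring_hom[OF I] by (auto simp: ring_hom_def)
  note cl = ideal_closed[OF I]
  show ?thesis
  proof (rule comm_groupI)
    fix \<phi> \<psi> assume h: "\<phi> \<in> carrier (Hom_quot I)" "\<psi> \<in> carrier (Hom_quot I)"
    have mem: "f \<in> I \<Longrightarrow> \<phi> f \<in> carrier (poly_ring Quot I)"
      "f \<in> I \<Longrightarrow> \<psi> f \<in> carrier (poly_ring Quot I)" for f
      using h by (auto simp: Hom_quot_def)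
    show "\<phi> \<otimes>\<^bsub>Hom_quot I\<^esub> \<psi> \<in> carrier (Hom_quot I)"
      using h mem proj by (auto simp: Hom_quot_def cl Q.a_ac Q.r_distr)
    show "\<phi> \<otimes>\<^bsub>Hom_quot I\<^esub> \<psi> = \<psi> \<otimes>\<^bsub>Hom_quot I\<^esub> \<phi>"
      using mem by (auto simp: Hom_quot_def Q.a_ac intro!: restrict_ext)
    fix \<chi> assume "\<chi> \<in> carrier (Hom_quot I)"
    then have "f \<in> I \<Longrightarrow> \<chi> f \<in> carrier (poly_ring Quot I)" for f
      by (auto simp: Hom_quot_def)
    with mem show "\<phi> \<otimes>\<^bsub>Hom_quot I\<^esub> \<psi> \<otimes>\<^bsub>Hom_quot I\<^esub> \<chi> = \<phi> \<otimes>\<^bsub>Hom_quot I\<^esub> (\<psi> \<otimes>\<^bsub>Hom_quot I\<^esub> \<chi>)"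
      by (auto simp: Hom_quot_def Q.a_ac intro!: restrict_ext)
  next
    show "\<one>\<^bsub>Hom_quot I\<^esub> \<in> carrier (Hom_quot I)"
      using proj by (auto simp: Hom_quot_def cl)
  next
    fix \<phi> assume h: "\<phi> \<in> carrier (Hom_quot I)"
    then have mem: "f \<in> I \<Longrightarrow> \<phi> f \<in> carrier (poly_ring Quot I)" for f
      by (auto simp: Hom_quot_def)
    show "\<one>\<^bsub>Hom_quot I\<^esub> \<otimes>\<^bsub>Hom_quot I\<^esub> \<phi> = \<phi>"
      using h mem by (auto simp: Hom_quot_def PiE_def extensional_def fun_eq_iff)
    let ?n = "\<lambda>f\<in>I. \<ominus>\<^bsub>poly_ring Quot I\<^esub> \<phi> f"
    have "?n \<in> carrier (Hom_quot I)"
      using h mem proj by (auto simp: Hom_quot_def cl Q.minus_add Q.r_minus)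
    moreover have "?n \<otimes>\<^bsub>Hom_quot I\<^esub> \<phi> = \<one>\<^bsub>Hom_quot I\<^esub>"
      using mem by (auto simp: Hom_quot_def Q.l_neg intro!: restrict_ext)
    ultimately show "\<exists>\<psi>\<in>carrier (Hom_quot I). \<psi> \<otimes>\<^bsub>Hom_quot I\<^esub> \<phi> = \<one>\<^bsub>Hom_quot I\<^esub>"
      by blast
  qed
qed

lemma subgroup_delta_star:
  assumes I: "ideal I (poly_ring :: ('v, 'k::field) mpoly ring)"
  shows "subgroup (delta_star I ` Der) (Hom_quot I)"
proof -
  interpret Q: cring "poly_ring Quot I"
    by (rule ideal.quotient_is_cring[OF I cring_poly_ring])
  interpret H: comm_group "Hom_quot I" by (rule comm_group_Hom_quot[OF I])
  define p where "p = (\<lambda>s. I +>\<^bsub>poly_ring\<^esub> s)"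
  have hom: "p \<in> ring_hom poly_ring (poly_ring Quot I)"
    unfolding p_def using ideal.rcos_ring_hom[OF I] by simp
  have p: "p s \<in> carrier (poly_ring Quot I)" "p (s + t) = p s \<oplus>\<^bsub>poly_ring Quot I\<^esub> p t"
    "p (s * t) = p s \<otimes>\<^bsub>poly_ring Quot I\<^esub> p t" for s t
    using hom by (auto simp: ring_hom_def)
  have p_I: "p f = \<zero>\<^bsub>poly_ring Quot I\<^esub>" if "f \<in> I" for f
    using ring.a_rcos_zero[OF cring.axioms(1)[OF cring_poly_ring] I that]
    by (simp add: p_def FactRing_def)
  note cl = ideal_closed[OF I]
  have delta: "delta_star I D = (\<lambda>f\<in>I. p (D f))" for D
    by (simp add: delta_star_def p_def)
  have into: "delta_star I D \<in> carrier (Hom_quot I)" if "D \<in> Der" for D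
    using that by (auto simp: delta Hom_quot_def Der_def p p_I cl p_def[symmetric])
  have add: "delta_star I D \<otimes>\<^bsub>Hom_quot I\<^esub> delta_star I D' = delta_star I (\<lambda>f. D f + D' f)" for D D'
    by (auto simp: delta Hom_quot_def p intro!: restrict_ext)
  have zero: "delta_star I (\<lambda>f. 0) = \<one>\<^bsub>Hom_quot I\<^esub>"
    using p_I[of 0] additive_subgroup.zero_closed[OF ideal.axioms(1)[OF I]]
    by (auto simp: delta Hom_quot_def intro!: restrict_ext)
  show ?thesis
  proof (rule H.subgroupI)
    show "delta_star I ` Der \<subseteq> carrier (Hom_quot I)" using into by blast
    have "(\<lambda>f. 0) \<in> Der" by (simp add: Der_def)
    then show "delta_star I ` Der \<noteq> {}" by blast
  next
    fix a assume "a \<in> delta_star I ` Der"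
    then obtain D where D: "D \<in> Der" "a = delta_star I D" by blast
    have n: "(\<lambda>f. - D f) \<in> Der" using D(1) by (auto simp: Der_def)
    have "delta_star I (\<lambda>f. - D f) \<otimes>\<^bsub>Hom_quot I\<^esub> a = \<one>\<^bsub>Hom_quot I\<^esub>"
      by (simp add: D add zero)
    then have "inv\<^bsub>Hom_quot I\<^esub> a = delta_star I (\<lambda>f. - D f)"
      using D into n by (simp add: H.inv_equality)
    with n show "inv\<^bsub>Hom_quot I\<^esub> a \<in> delta_star I ` Der" by blast
  next
    fix a b assume "a \<in> delta_star I ` Der" "b \<in> delta_star I ` Der"
    then obtain D D' where D: "D \<in> Der" "D' \<in> Der" "a = delta_star I D" "b = delta_star I D'"
      by blast
    have "(\<lambda>f. D f + D' f) \<in> Der"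
      using D(1,2) by (auto simp: Der_def algebra_simps)
    then show "a \<otimes>\<^bsub>Hom_quot I\<^esub> b \<in> delta_star I ` Der"
      by (auto simp: D(3,4) add)
  qed
qed

end

theory Submission
  imports Defs
begin

text \<open>A homomorphism \<open>\<phi>\<close> from \<open>I\<close> to \<open>S/I\<close> is given by the classes of \<open>\<phi> (x\<^sub>i x\<^sub>j)\<close>, subject to
  the pairwise syzygies, and splits into multigraded pieces of degree \<open>a - b\<close>, where \<open>a\<close> may be
  taken to be the indicator of an independent set \<open>A\<close> and \<open>b\<close> is \<open>x\<^sub>i\<close> or \<open>x\<^sub>i x\<^sub>j\<close> for an edge
  \<open>{i, j}\<close>. Hence rigidity forces two conditions: in \<open>N(i) - N(A)\<close> no vertex is adjacent to all
  the others, unless it is the only one; and \<open>N(i) \<union> N(j) - {i, j}\<close> is never contained in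
  \<open>N(A)\<close>. In the absence of induced cycles of length 4, 5 and 6 a minimal set of vertices
  outside \<open>N[i] \<union> N[j]\<close> dominating a part of \<open>N(i) \<union> N(j)\<close> is independent, and suitable such sets
  show first that every vertex of a triangle has a free neighbour and then that every edge is a
  branch. Conversely, free neighbours turn the syzygies into the statement that, for a monomial
  \<open>m\<close> not divisible by \<open>x\<^sub>i\<close>, the coefficient of \<open>\<phi> (x\<^sub>i x\<^sub>j)\<close> at \<open>x\<^sub>j m\<close> does not depend on the
  neighbour \<open>j\<close>; it is the coefficient at \<open>m\<close> of the image of \<open>x\<^sub>i\<close> under the derivation.\<close>

subsection \<open>Neighbourhoods and induced cycles\<close>

definition nbrs :: "'v set set \<Rightarrow> 'v \<Rightarrow> 'v set" where
  "nbrs E v = {u. {v, u} \<in> E}"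

definition indep :: "'v set set \<Rightarrow> 'v set \<Rightarrow> bool" where
  "indep E A \<longleftrightarrow> (\<forall>u\<in>A. \<forall>v\<in>A. {u, v} \<notin> E)"

lemma nbrs_sym: "u \<in> nbrs E v \<longleftrightarrow> v \<in> nbrs E u"
  by (simp add: nbrs_def insert_commute)

lemma nbrs_symD: "u \<in> nbrs E v \<Longrightarrow> v \<in> nbrs E u"
  by (simp add: nbrs_def insert_commute)

lemma nbrs_irrefl:
  assumes "simple_graph E" shows "v \<notin> nbrs E v"
  using assms by (auto simp: simple_graph_def nbrs_def)

lemma edge_obtain_other:
  assumes "simple_graph E" "e \<in> E" "v \<in> e"
  obtains w where "e = {v, w}" "w \<noteq> v" "w \<in> nbrs E v"
proof -
  obtain a b where ab: "e = {a, b}" "a \<noteq> b"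
    using assms(1,2) unfolding simple_graph_def card_2_iff by blast
  show thesis
  proof (cases "v = a")
    case True
    then show ?thesis using that[of b] ab assms(2) by (auto simp: nbrs_def)
  next
    case False
    then have "v = b" using ab assms(3) by blast
    then show ?thesis using that[of a] ab assms(2) by (auto simp: nbrs_def insert_commute)
  qed
qed

lemma degree_eq_card_nbrs:
  assumes "simple_graph E"
  shows "degree E v = card (nbrs E v)"
proof -
  have "{e \<in> E. v \<in> e} = (\<lambda>u. {v, u}) ` nbrs E v"
    using assms by (fastforce simp: simple_graph_def nbrs_def card_2_iff insert_commute)
  moreover have "inj_on (\<lambda>u. {v, u}) (nbrs E v)"
    by (auto simp: inj_on_def doubleton_eq_iff)
  ultimately show ?thesis by (simp add: Defs.degree_def card_image)
qed

lemma free_vertex_iff: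
  assumes "simple_graph E"
  shows "free_vertex E v \<longleftrightarrow> (\<exists>u. nbrs E v = {u})"
  using degree_eq_card_nbrs[OF assms] by (simp add: free_vertex_def card_1_singleton_iff)

lemma branch_iff:
  assumes "simple_graph E" "{i, j} \<in> E"
  shows "branch E {i, j} \<longleftrightarrow>
    (\<exists>k. k \<noteq> i \<and> k \<noteq> j \<and> (nbrs E k = {i} \<or> nbrs E k = {j}))"
proof
  assume "branch E {i, j}"
  then obtain e v where e: "e \<in> E" "e \<noteq> {i, j}" "e \<inter> {i, j} \<noteq> {}" "v \<in> e" "free_vertex E v"
    by (auto simp: branch_def leaf_def Int_commute)
  obtain w where w: "e = {v, w}" using edge_obtain_other[OF assms(1) e(1,4)] by blast
  obtain u where u: "nbrs E v = {u}" using e(5) free_vertex_iff[OF assms(1)] by blast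
  have "w \<in> nbrs E v" using e(1) w by (simp add: nbrs_def)
  with u have nv: "nbrs E v = {w}" by simp
  \<comment> \<open>If the free vertex \<open>v\<close> were an endpoint of \<open>{i, j}\<close>,
    its only edge would be \<open>{i, j}\<close>, contrary to
    \<open>e \<noteq> {i, j}\<close>.\<close>
  have "v \<noteq> i"
    using assms(2) nv e(2) w by (auto simp: nbrs_def)
  moreover have "v \<noteq> j"
    using assms(2) nv e(2) w by (auto simp: nbrs_def insert_commute)
  ultimately show "\<exists>k. k \<noteq> i \<and> k \<noteq> j \<and> (nbrs E k = {i} \<or> nbrs E k = {j})"
    using nv e(3) w by auto
next
  assume "\<exists>k. k \<noteq> i \<and> k \<noteq> j \<and> (nbrs E k = {i} \<or> nbrs E k = {j})"
  then obtain k l where k: "k \<noteq> i" "k \<noteq> j" "nbrs E k = {l}" "l \<in> {i, j}" by blast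
  have "{k, l} \<in> E" using k(3) by (auto simp: nbrs_def)
  moreover have "free_vertex E k" using k(3) free_vertex_iff[OF assms(1)] by blast
  ultimately show "branch E {i, j}"
    using k assms(2) unfolding branch_def leaf_def by (intro conjI exI[of _ "{k, l}"]) auto
qed

text \<open>The two distinct neighbours \<open>u\<close> and \<open>w\<close> keep \<open>v\<close>
  itself from being free, so the free vertex of a leaf at \<open>v\<close> is its other
  endpoint.\<close>

lemma in_leaf_iff:
  assumes "simple_graph E" "u \<in> nbrs E v" "w \<in> nbrs E v" "u \<noteq> w"
  shows "(\<exists>e. leaf E e \<and> v \<in> e) \<longleftrightarrow> (\<exists>p. nbrs E p = {v})"
proof
  assume "\<exists>e. leaf E e \<and> v \<in> e"
  then obtain e p where e: "e \<in> E" "v \<in> e" "p \<in> e" "free_vertex E p" by (auto simp: leaf_def)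
  obtain q where q: "nbrs E p = {q}" using e(4) free_vertex_iff[OF assms(1)] by blast
  have "p \<noteq> v" using q assms by auto
  obtain w where "e = {p, w}" "w \<in> nbrs E p" using edge_obtain_other[OF assms(1) e(1,3)] by blast
  then have "nbrs E p = {v}" using e(2) q \<open>p \<noteq> v\<close> by auto
  then show "\<exists>p. nbrs E p = {v}" by blast
next
  assume "\<exists>p. nbrs E p = {v}"
  then obtain p where p: "nbrs E p = {v}" by blast
  then have "{p, v} \<in> E" by (auto simp: nbrs_def)
  with p show "\<exists>e. leaf E e \<and> v \<in> e"
    using free_vertex_iff[OF assms(1), of p] by (auto simp: leaf_def intro!: exI[of _ "{p, v}"])
qed

lemma cycle_three_iff:
  "cycle E [a, b, c] \<longleftrightarrow> distinct [a, b, c] \<and> {a, b} \<in> E \<and> {b, c} \<in> E \<and> {c, a} \<in> E"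
proof -
  have "cycle_edges [a, b, c] = (\<lambda>i. {[a, b, c] ! i, [a, b, c] ! (Suc i mod 3)}) ` {..<3}"
    by (auto simp: cycle_edges_def)
  also have "\<dots> = {{a, b}, {b, c}, {c, a}}"
  proof -
    have "{..<3::nat} = {0, 1, 2}" by auto
    then show ?thesis by simp
  qed
  finally have "cycle_edges [a, b, c] = {{a, b}, {b, c}, {c, a}}" .
  then show ?thesis by (auto simp: cycle_def)
qed

lemma triangle_leaf_iff:
  assumes "simple_graph E"
  shows "(\<forall>vs. cycle E vs \<and> length vs = 3 \<longrightarrow> (\<forall>v\<in>set vs. \<exists>e. leaf E e \<and> v \<in> e))
    \<longleftrightarrow> (\<forall>i j k. j \<in> nbrs E i \<and> k \<in> nbrs E i \<and> k \<in> nbrs E j \<longrightarrow> (\<exists>p. nbrs E p = {i}))"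
    (is "?L \<longleftrightarrow> ?R")
proof
  assume L: ?L
  show ?R
  proof (intro allI impI)
    fix i j k assume h: "j \<in> nbrs E i \<and> k \<in> nbrs E i \<and> k \<in> nbrs E j"
    then have ne: "i \<noteq> j" "i \<noteq> k" "j \<noteq> k" using nbrs_irrefl[OF assms] by blast+
    have "cycle E [i, j, k]" using h ne by (auto simp: cycle_three_iff nbrs_def insert_commute)
    then have "\<exists>e. leaf E e \<and> i \<in> e" using L[rule_format, of "[i, j, k]" i] by simp
    then show "\<exists>p. nbrs E p = {i}" using in_leaf_iff[OF assms, of j i k] h ne by blast
  qed
next
  assume R: ?R
  show ?L
  proof (intro allI impI ballI)
    fix vs v assume h: "cycle E vs \<and> length vs = 3" and v: "v \<in> set vs"
    from h obtain a b c where vs: "vs = [a, b, c]" by (auto simp: numeral_3_eq_3 length_Suc_conv)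
    have abc: "distinct [a, b, c]" "b \<in> nbrs E a" "c \<in> nbrs E b" "a \<in> nbrs E c"
      using h vs by (auto simp: cycle_three_iff nbrs_def)
    then have "c \<in> nbrs E a" "b \<in> nbrs E c" "a \<in> nbrs E b" by (simp_all add: nbrs_def insert_commute)
    with v vs abc obtain u w where "u \<in> nbrs E v" "w \<in> nbrs E v" "w \<in> nbrs E u" "u \<noteq> w"
      by (metis distinct_length_2_or_more list.set_intros(1) set_ConsD empty_iff list.set(1))
    then show "\<exists>e. leaf E e \<and> v \<in> e" using R in_leaf_iff[OF assms] by blast
  qed
qed

section \<open>Criteria for induced cycles of length 4, 5 and 6\<close>

lemma induced_cycleI:
  assumes "simple_graph E" "3 \<le> length vs" "distinct vs"
    and "\<forall>j<length vs. \<forall>i<j. vs ! j \<in> nbrs E (vs ! i) \<longleftrightarrow>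
      j = Suc i \<or> (i = 0 \<and> Suc j = length vs)"
  shows "induced_cycle E vs"
proof -
  let ?n = "length vs"
  \<comment> \<open>Only positions \<open>i < j\<close> are compared, so the closing edge appears as
    the pair of the first and the last position.\<close>
  have adj: "{vs ! i, vs ! j} \<in> E \<longleftrightarrow> j = Suc i \<or> (i = 0 \<and> Suc j = ?n)" if "i < j" "j < ?n" for i j
    using assms(4) that by (simp add: nbrs_def)
  have 1: "cycle_edges vs \<subseteq> E"
  proof
    fix e assume "e \<in> cycle_edges vs"
    then obtain i where i: "i < ?n" "e = {vs ! i, vs ! (Suc i mod ?n)}" by (auto simp: cycle_edges_def)
    show "e \<in> E"
    proof (cases "Suc i = ?n")
      case True
      then show ?thesis using i adj[of 0 i] assms(2) by (simp add: insert_commute)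
    next
      case False
      then show ?thesis using i adj[of i "Suc i"] by simp
    qed
  qed
  have 2: "cycle_edges vs \<subseteq> {e. e \<subseteq> set vs}"
    by (auto simp: cycle_edges_def) (metis length_pos_if_in_set mod_less_divisor nth_mem)
  have ce: "{vs ! i, vs ! j} \<in> cycle_edges vs" if "i < j" "j < ?n" "{vs ! i, vs ! j} \<in> E" for i j
    using adj[OF that(1,2)] that
  proof (cases "j = Suc i")
    case True
    then show ?thesis using that unfolding cycle_edges_def by (intro CollectI exI[of _ i]) simp
  next
    case False
    then have "i = 0" "Suc j = ?n" using adj[OF that(1,2)] that by auto
    then show ?thesis using that unfolding cycle_edges_def
      by (intro CollectI exI[of _ j]) (auto simp: insert_commute)
  qed
  have 3: "e \<in> cycle_edges vs" if e: "e \<in> E" "e \<subseteq> set vs" for e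
  proof -
    from e(1) assms(1) obtain a b where ab: "e = {a, b}" "a \<noteq> b"
      unfolding simple_graph_def card_2_iff by blast
    with e(2) obtain i j where ij: "i < ?n" "j < ?n" "a = vs ! i" "b = vs ! j"
      by (auto simp: in_set_conv_nth)
    with ab have "i < j \<or> j < i" by (metis linorder_neqE_nat)
    then show ?thesis using ce[of i j] ce[of j i] ij ab e(1) by (auto simp: insert_commute)
  qed
  show ?thesis using 1 2 3 assms(2,3) unfolding induced_cycle_def cycle_def by blast
qed

text \<open>Opposite vertices of a 4-cycle have the same neighbours on it, so their distinctness is
  assumed in \<open>ne\<close>; for lengths 5 and 6 it follows from the adjacencies.\<close>

lemma induced_cycle_4:
  assumes G: "simple_graph E"
    and adj: "w \<in> nbrs E a" "a' \<in> nbrs E a" "w' \<in> nbrs E a'" "w' \<in> nbrs E w"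
    and nadj: "w \<notin> nbrs E a'" "w' \<notin> nbrs E a"
    and ne: "w \<noteq> a'" "a \<noteq> w'"
  shows "\<exists>vs. induced_cycle E vs \<and> length vs \<in> {4, 5, 6}"
proof -
  have sym: "x \<in> nbrs E y \<Longrightarrow> y \<in> nbrs E x" "x \<notin> nbrs E y \<Longrightarrow> y \<notin> nbrs E x" for x y
    using nbrs_sym[of x E y] by simp_all
  note facts = adj nadj adj[THEN sym(1)] nadj[THEN sym(2)]
  have sep: "z \<in> nbrs E x \<Longrightarrow> z \<notin> nbrs E y \<Longrightarrow> x \<noteq> y" for x y z by blast
  have "distinct [w, a, a', w']"
    using ne facts nbrs_irrefl[OF G] by (auto dest: sep)
  with facts have "induced_cycle E [w, a, a', w']"
    by (intro induced_cycleI[OF G]) (simp_all add: All_less_Suc numeral_eq_Suc)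
  then show ?thesis by force
qed

lemma induced_cycle_5:
  assumes G: "simple_graph E"
    and adj: "w \<in> nbrs E a" "a' \<in> nbrs E a" "w' \<in> nbrs E a'" "w \<in> nbrs E k" "w' \<in> nbrs E k"
    and nadj: "w \<notin> nbrs E a'" "w' \<notin> nbrs E a" "w' \<notin> nbrs E w" "a \<notin> nbrs E k" "a' \<notin> nbrs E k"
  shows "\<exists>vs. induced_cycle E vs \<and> length vs \<in> {4, 5, 6}"
proof -
  have sym: "x \<in> nbrs E y \<Longrightarrow> y \<in> nbrs E x" "x \<notin> nbrs E y \<Longrightarrow> y \<notin> nbrs E x" for x y
    using nbrs_sym[of x E y] by simp_all
  note facts = adj nadj adj[THEN sym(1)] nadj[THEN sym(2)]
  have sep: "z \<in> nbrs E x \<Longrightarrow> z \<notin> nbrs E y \<Longrightarrow> x \<noteq> y" for x y z by blast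
  have "distinct [w, a, a', w', k]"
    using facts nbrs_irrefl[OF G] by (auto dest: sep)
  with facts have "induced_cycle E [w, a, a', w', k]"
    by (intro induced_cycleI[OF G]) (simp_all add: All_less_Suc numeral_eq_Suc)
  then show ?thesis by force
qed

lemma induced_cycle_6:
  assumes G: "simple_graph E"
    and adj: "w \<in> nbrs E a" "a' \<in> nbrs E a" "w' \<in> nbrs E a'" "w \<in> nbrs E k" "w' \<in> nbrs E l" "l \<in> nbrs E k"
    and nadj: "w \<notin> nbrs E a'" "w' \<notin> nbrs E a" "w' \<notin> nbrs E w" "a \<notin> nbrs E k" "a' \<notin> nbrs E k"
      "a \<notin> nbrs E l" "a' \<notin> nbrs E l" "w \<notin> nbrs E l" "w' \<notin> nbrs E k"
  shows "\<exists>vs. induced_cycle E vs \<and> length vs \<in> {4, 5, 6}"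
proof -
  have sym: "x \<in> nbrs E y \<Longrightarrow> y \<in> nbrs E x" "x \<notin> nbrs E y \<Longrightarrow> y \<notin> nbrs E x" for x y
    using nbrs_sym[of x E y] by simp_all
  note facts = adj nadj adj[THEN sym(1)] nadj[THEN sym(2)]
  have sep: "z \<in> nbrs E x \<Longrightarrow> z \<notin> nbrs E y \<Longrightarrow> x \<noteq> y" for x y z by blast
  have "distinct [w, a, a', w', l, k]"
    using facts nbrs_irrefl[OF G] by (auto dest: sep)
  with facts have "induced_cycle E [w, a, a', w', l, k]"
    by (intro induced_cycleI[OF G]) (simp_all add: All_less_Suc numeral_eq_Suc)
  then show ?thesis by force
qed

text \<open>A minimal cover \<open>A\<close> is independent: private neighbours \<open>w\<close>, \<open>w'\<close> of two adjacent elements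
  of \<open>A\<close> would close up to an induced cycle of length 4, 5 or 6, according to whether \<open>w\<close> and
  \<open>w'\<close> are adjacent or have a common neighbour in \<open>{i, j}\<close>. The case \<open>i = j\<close> is allowed.\<close>

lemma independent_cover:
  fixes E :: "'v::finite set set"
  assumes G: "simple_graph E" and nocyc: "\<nexists>vs. induced_cycle E vs \<and> length vs \<in> {4, 5, 6}"
    and ij: "i = j \<or> j \<in> nbrs E i"
    and X: "X \<subseteq> nbrs E i \<union> nbrs E j"
    and B: "B \<inter> ({i, j} \<union> nbrs E i \<union> nbrs E j) = {}"
    and XB: "\<And>x. x \<in> X \<Longrightarrow> nbrs E x \<inter> B \<noteq> {}"
  obtains A where "A \<subseteq> B" "indep E A" "\<And>x. x \<in> X \<Longrightarrow> nbrs E x \<inter> A \<noteq> {}"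
proof -
  let ?C = "{A. A \<subseteq> B \<and> (\<forall>x\<in>X. nbrs E x \<inter> A \<noteq> {})}"
  have "B \<in> ?C" using XB by blast
  then obtain A where A: "A \<in> ?C" and min: "\<And>A'. A' \<in> ?C \<Longrightarrow> A' \<subseteq> A \<Longrightarrow> A' = A"
    using finite_has_minimal[of ?C] by (metis (no_types, lifting) empty_iff finite)
  note sym = nbrs_sym[of _ E] and irr = nbrs_irrefl[OF G]
  have "indep E A"
    unfolding indep_def
  proof (intro ballI notI)
    fix a a' assume a: "a \<in> A" "a' \<in> A" and "{a, a'} \<in> E"
    then have aa': "a' \<in> nbrs E a" by (simp add: nbrs_def)
    \<comment> \<open>By minimality \<open>A - {b}\<close> is no longer a cover, so some
      \<open>w\<close> in \<open>X\<close> has \<open>b\<close> as its only neighbour in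
      \<open>A\<close>.\<close>
    have priv: "\<exists>w\<in>X. w \<in> nbrs E b \<and> (\<forall>c\<in>A. c \<noteq> b \<longrightarrow> w \<notin> nbrs E c)" if b: "b \<in> A" for b
    proof (rule ccontr)
      assume "\<not> ?thesis"
      then have "A - {b} \<in> ?C" using A sym by fastforce
      then have "A - {b} = A" by (rule min) blast
      with b show False by blast
    qed
    have "a \<noteq> a'" using aa' irr by blast
    obtain w where w: "w \<in> X" "w \<in> nbrs E a" "w \<notin> nbrs E a'" using priv[OF a(1)] a \<open>a \<noteq> a'\<close> by metis
    obtain w' where w': "w' \<in> X" "w' \<in> nbrs E a'" "w' \<notin> nbrs E a"
      using priv[OF a(2)] a \<open>a \<noteq> a'\<close> by metis
    have ab: "a \<in> B" "a' \<in> B" using A a by auto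
    have d: "a \<notin> {i, j}" "a' \<notin> {i, j}" "a \<notin> nbrs E i" "a \<notin> nbrs E j" "a' \<notin> nbrs E i" "a' \<notin> nbrs E j"
      using ab B by auto
    have "w \<noteq> a'" "a \<noteq> w'" using w(1) w'(1) X d by blast+
    then have no4: "w' \<notin> nbrs E w"
      using induced_cycle_4[OF G w(2) aa' w'(2) _ w(3) w'(3)] nocyc by blast
    have no5: False if k: "k \<in> {i, j}" "w \<in> nbrs E k" "w' \<in> nbrs E k" for k
    proof -
      have dk: "a \<notin> nbrs E k" "a' \<notin> nbrs E k" using d k(1) by auto
      show False
        using induced_cycle_5[OF G w(2) aa' w'(2) k(2,3) w(3) w'(3) no4 dk] nocyc by blast
    qed
    have no6: False if k: "k \<in> {i, j}" "l \<in> {i, j}" "w \<in> nbrs E k" "w' \<in> nbrs E l"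
      "w \<notin> nbrs E l" "w' \<notin> nbrs E k" for k l
    proof -
      have dk: "a \<notin> nbrs E k" "a' \<notin> nbrs E k" "a \<notin> nbrs E l" "a' \<notin> nbrs E l" using d k(1,2) by auto
      have "l \<noteq> k" using k by auto
      then have "l \<in> nbrs E k" using ij k(1,2) nbrs_sym[of i E j] by auto
      then show False
        using induced_cycle_6[OF G w(2) aa' w'(2) k(3,4) _ w(3) w'(3) no4 dk k(5,6)] nocyc by blast
    qed
    have "w \<in> nbrs E i \<union> nbrs E j" "w' \<in> nbrs E i \<union> nbrs E j" using X w(1) w'(1) by blast+
    then show False using no5[of i] no5[of j] no6[of i j] no6[of j i] by blast
  qed
  with A that show thesis by blast
qed

subsection \<open>The two combinatorial consequences of rigidity\<close>

text \<open>The last two assumptions are the conclusions of \<open>rigid_no_dominating\<close> and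
  \<open>rigid_no_isolated_edge\<close>, which frees the graph argument from any reference to a
  field.\<close>

locale inseparable_graph =
  fixes E :: "'v::finite set set"
  assumes G: "simple_graph E"
    and nocyc: "\<nexists>vs. induced_cycle E vs \<and> length vs \<in> {4, 5, 6}"
    and no_dominating: "\<lbrakk>indep E A; i \<notin> A; j \<in> nbrs E i; nbrs E j \<inter> A = {};
        \<And>k. \<lbrakk>k \<in> nbrs E i; nbrs E k \<inter> A = {}; k \<noteq> j\<rbrakk> \<Longrightarrow> k \<in> nbrs E j;
        k \<in> nbrs E i; nbrs E k \<inter> A = {}\<rbrakk> \<Longrightarrow> k = j"
    and no_isolated_edge: "\<lbrakk>indep E A; i \<notin> A; j \<notin> A; j \<in> nbrs E i\<rbrakk>
        \<Longrightarrow> \<exists>k\<in>(nbrs E i \<union> nbrs E j) - {i, j}. nbrs E k \<inter> A = {}"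
begin

lemma sym: "u \<in> nbrs E v \<Longrightarrow> v \<in> nbrs E u"
  using nbrs_sym by metis

lemma irrefl: "v \<notin> nbrs E v"
  by (rule nbrs_irrefl[OF G])

text \<open>Otherwise \<open>j\<close>, \<open>i\<close>, \<open>k\<close>, \<open>b\<close> would
  form an induced 4-cycle.\<close>

lemma common_nbr_adjacent:
  assumes "j \<in> nbrs E i" "k \<in> nbrs E i" "j \<noteq> k" "b \<in> nbrs E j" "b \<in> nbrs E k"
    and "b \<noteq> i" "b \<notin> nbrs E i"
  shows "k \<in> nbrs E j"
proof (rule ccontr)
  assume "k \<notin> nbrs E j"
  then have "j \<notin> nbrs E k" using sym by blast
  with nocyc show False
    using induced_cycle_4[OF G assms(1,2,5,4) _ assms(7,3) assms(6)[symmetric]] by blast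
qed

lemma indep_empty: "indep E {}"
  by (simp add: indep_def)

text \<open>Otherwise every other neighbour of the edge has a neighbour in \<open>?B\<close>, and an
  independent cover taken from \<open>?B\<close> contradicts
  \<open>no_isolated_edge\<close>.\<close>

lemma enclosed_nbr:
  assumes "j \<in> nbrs E i"
  shows "\<exists>k\<in>nbrs E i \<union> nbrs E j - {i, j}. nbrs E k \<subseteq> {i, j} \<union> nbrs E i \<union> nbrs E j"
proof (rule ccontr)
  assume no: "\<not> ?thesis"
  let ?B = "- ({i, j} \<union> nbrs E i \<union> nbrs E j)"
  let ?X = "nbrs E i \<union> nbrs E j - {i, j}"
  have cov: "nbrs E x \<inter> ?B \<noteq> {}" if "x \<in> ?X" for x
    using no that by blast
  obtain A where A: "A \<subseteq> ?B" "indep E A" "\<And>x. x \<in> ?X \<Longrightarrow> nbrs E x \<inter> A \<noteq> {}"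
  proof (rule independent_cover[OF G nocyc, of i j ?X ?B])
  qed (use assms cov in auto)
  then have "i \<notin> A" "j \<notin> A" by auto
  then show False using no_isolated_edge[OF A(2) _ _ assms] A(3) by blast
qed

lemma triangle_has_leaf:
  assumes tri: "j \<in> nbrs E i" "k \<in> nbrs E i" "k \<in> nbrs E j"
  shows "\<exists>p. nbrs E p = {i}"
proof (rule ccontr)
  assume nofree: "\<nexists>p. nbrs E p = {i}"
  define B where "B = - insert i (nbrs E i)"
  \<comment> \<open>If \<open>l\<close> had no neighbour in \<open>B\<close>, then \<open>i\<close>
    would dominate the neighbours of \<open>l\<close>, and \<open>no_dominating\<close> with empty
    \<open>A\<close> would leave \<open>i\<close> as the only one.\<close>
  have C_ne: "nbrs E l \<inter> B \<noteq> {}" if l: "l \<in> nbrs E i" for l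
  proof
    assume "nbrs E l \<inter> B = {}"
    then have sub: "nbrs E l \<subseteq> insert i (nbrs E i)" by (auto simp: B_def)
    have "x = i" if "x \<in> nbrs E l" for x
      using no_dominating[OF indep_empty, of l i x] that sub l sym by blast
    then have "nbrs E l = {i}" using l sym by blast
    with nofree show False by blast
  qed
  have not_sub: "\<not> nbrs E l \<inter> B \<subseteq> nbrs E m \<inter> B"
    if lm: "l \<in> nbrs E i" "m \<in> nbrs E i" "m \<in> nbrs E l" for l m
  proof
    assume sub: "nbrs E l \<inter> B \<subseteq> nbrs E m \<inter> B"
    \<comment> \<open>\<open>?X\<close> collects the common neighbours of \<open>i\<close> and
      \<open>l\<close> that \<open>m\<close> fails to dominate. Since a neighbour in
      \<open>B\<close> shared with \<open>m\<close> would make \<open>x\<close> and \<open>m\<close>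
      adjacent, \<open>?X\<close> can be covered from outside the neighbourhood of \<open>m\<close>.
      What survives around \<open>l\<close> is dominated by \<open>m\<close> and includes
      \<open>i\<close>.\<close>
    let ?X = "{x \<in> nbrs E i. x \<in> nbrs E l \<and> x \<noteq> m \<and> x \<notin> nbrs E m}"
    let ?B = "B - nbrs E m"
    have cov: "nbrs E x \<inter> ?B \<noteq> {}" if x: "x \<in> ?X" for x
      using C_ne[of x] common_nbr_adjacent[of m i x] x lm by (auto simp: B_def)
    obtain A where A: "A \<subseteq> ?B" "indep E A" "\<And>x. x \<in> ?X \<Longrightarrow> nbrs E x \<inter> A \<noteq> {}"
    proof (rule independent_cover[OF G nocyc, of i i ?X ?B])
    qed (use cov in \<open>auto simp: B_def\<close>)
    have "l \<notin> A" "nbrs E m \<inter> A = {}" "nbrs E i \<inter> A = {}"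
      using A(1) lm by (auto simp: B_def)
    moreover have "x \<in> nbrs E m" if "x \<in> nbrs E l" "nbrs E x \<inter> A = {}" "x \<noteq> m" for x
      using that A(3)[of x] sub lm sym unfolding B_def by blast
    ultimately have "i = m"
      using no_dominating[of A l m i] A(2) lm sym by blast
    with lm irrefl show False by blast
  qed
  \<comment> \<open>The vertex \<open>c\<close> enclosed by the edge \<open>{i, l}\<close> is not
    adjacent to \<open>i\<close>, by \<open>not_sub\<close>. So it lies in \<open>B\<close>, its
    neighbours are dominated by \<open>l\<close>, and \<open>no_dominating\<close> with empty
    \<open>A\<close> makes it free.\<close>
  have free: "\<exists>b\<in>B. nbrs E b = {l}" if l: "l \<in> nbrs E i" for l
  proof -
    obtain c where c: "c \<in> nbrs E i \<union> nbrs E l" "c \<noteq> i" "c \<noteq> l"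
      and sub: "nbrs E c \<subseteq> {i, l} \<union> nbrs E i \<union> nbrs E l"
      using enclosed_nbr[OF l] by blast
    have "c \<notin> nbrs E i"
    proof
      assume ci: "c \<in> nbrs E i"
      have subB: "nbrs E c \<inter> B \<subseteq> nbrs E l \<inter> B" using sub l by (auto simp: B_def)
      obtain b where "b \<in> nbrs E c" "b \<in> B" using C_ne[OF ci] by blast
      then have "l \<in> nbrs E c"
        using common_nbr_adjacent[of c i l b] ci l c(3) subB by (auto simp: B_def)
      with not_sub[OF ci l] subB show False by blast
    qed
    then have cl: "c \<in> nbrs E l" "c \<in> B" using c by (auto simp: B_def)
    have dom: "x \<in> nbrs E l" if x: "x \<in> nbrs E c" "x \<noteq> l" for x
    proof (cases "x \<in> nbrs E i")
      case True
      then show ?thesis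
        using common_nbr_adjacent[of l i x c] x l cl sym[OF x(1)] by (auto simp: B_def)
    next
      case False
      moreover have "x \<noteq> i" using x \<open>c \<notin> nbrs E i\<close> sym by blast
      ultimately show ?thesis using sub x by blast
    qed
    have "x = l" if "x \<in> nbrs E c" for x
      using no_dominating[OF indep_empty, of c l x] that dom cl sym by blast
    then have "nbrs E c = {l}" using cl sym by blast
    with cl show ?thesis by blast
  qed
  then obtain b where b: "\<And>l. l \<in> nbrs E i \<Longrightarrow> b l \<in> B \<and> nbrs E (b l) = {l}" by metis
  \<comment> \<open>One free vertex attached to each neighbour of \<open>i\<close> other than
    \<open>j\<close> and \<open>k\<close> leaves just these two adjacent vertices uncovered, which
    \<open>no_dominating\<close> forbids.\<close>
  define A where "A = b ` (nbrs E i - {j, k})"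
  have jk: "j \<noteq> k" using tri irrefl by blast
  have "indep E A"
    unfolding indep_def
  proof (intro ballI notI)
    fix u v assume u: "u \<in> A" and v: "v \<in> A" and "{u, v} \<in> E"
    then have "v \<in> nbrs E u" by (simp add: nbrs_def)
    then have "v \<in> nbrs E i" using u b by (auto simp: A_def)
    then show False using v b by (auto simp: A_def B_def)
  qed
  moreover have "i \<notin> A" using b by (auto simp: A_def B_def)
  moreover have surv: "nbrs E l \<inter> A = {}" if "l \<in> {j, k}" for l
  proof -
    have "l \<noteq> x" "l \<notin> nbrs E (b x)" if "x \<in> nbrs E i - {j, k}" for x
      using b[of x] that \<open>l \<in> {j, k}\<close> by auto
    then show ?thesis using sym unfolding A_def by blast
  qed
  moreover have "x \<in> {j, k}" if x: "x \<in> nbrs E i" "nbrs E x \<inter> A = {}" for x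
  proof (rule ccontr)
    assume "x \<notin> {j, k}"
    then have "b x \<in> A" using x by (simp add: A_def)
    moreover have "b x \<in> nbrs E x" using b[OF x(1)] sym by blast
    ultimately show False using x by blast
  qed
  ultimately have "k = j"
    using no_dominating[of A i j k] tri by blast
  with jk show False by blast
qed

lemma edge_has_branch:
  assumes e: "j \<in> nbrs E i"
  shows "\<exists>k. k \<noteq> i \<and> k \<noteq> j \<and> (nbrs E k = {i} \<or> nbrs E k = {j})"
proof -
  \<comment> \<open>A second neighbour of \<open>k\<close> would give a triangle through
    \<open>i\<close> and \<open>k\<close>, hence a free vertex \<open>q\<close> attached to
    \<open>k\<close>. By \<open>sub\<close>, \<open>q\<close> would then be one of \<open>i\<close>,
    \<open>j\<close> or adjacent to one of them, and so have a neighbour other than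
    \<open>k\<close>.\<close>
  have main: "nbrs E k = {i}" if ij: "j \<in> nbrs E i" and k: "k \<in> nbrs E i" "k \<noteq> i" "k \<noteq> j"
    and sub: "nbrs E k \<subseteq> {i, j} \<union> nbrs E i \<union> nbrs E j" for i j k
  proof (rule ccontr)
    assume "nbrs E k \<noteq> {i}"
    then obtain l where l: "l \<in> nbrs E k" "l \<noteq> i" using k(1) sym by blast
    have "\<exists>x. x \<in> nbrs E k \<and> x \<in> nbrs E i"
    proof (cases "l \<in> nbrs E i \<or> l = j \<or> k \<in> nbrs E j")
      case True
      then show ?thesis using l ij sym by blast
    next
      case False
      \<comment> \<open>The 4-cycle \<open>k\<close>, \<open>i\<close>, \<open>j\<close>,
        \<open>l\<close> has no chord in this case, which \<open>common_nbr_adjacent\<close> rules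
        out.\<close>
      then have "l \<in> nbrs E j" using l sub by blast
      then show ?thesis
        using common_nbr_adjacent[of k i j l] ij k l False sym by blast
    qed
    then obtain q where q: "nbrs E q = {k}" using triangle_has_leaf[of i k] k(1) sym by blast
    then have "q \<in> nbrs E k" using sym by blast
    then have "q \<in> {i, j} \<union> nbrs E i \<union> nbrs E j" using sub by blast
    then consider "q = i" | "q = j" | "i \<in> nbrs E q" | "j \<in> nbrs E q" using sym by blast
    then show False using q ij sym[OF ij] k by cases auto
  qed
  obtain k where "k \<in> nbrs E i \<union> nbrs E j" "k \<noteq> i" "k \<noteq> j"
    "nbrs E k \<subseteq> {i, j} \<union> nbrs E i \<union> nbrs E j"
    using enclosed_nbr[OF e] by blast
  then show ?thesis using main[of j i k] main[of i j k] e sym by blast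
qed

end

subsection \<open>Monomials and derivations\<close>

abbreviation lookup :: "('a \<Rightarrow>\<^sub>0 'b::zero) \<Rightarrow> 'a \<Rightarrow> 'b" where
  "lookup \<equiv> Poly_Mapping.lookup"

abbreviation keys :: "('a \<Rightarrow>\<^sub>0 'b::zero) \<Rightarrow> 'a set" where
  "keys \<equiv> Poly_Mapping.keys"

abbreviation single :: "'a \<Rightarrow> 'b \<Rightarrow> 'a \<Rightarrow>\<^sub>0 'b::zero" where
  "single \<equiv> Poly_Mapping.single"

abbreviation expo :: "'v \<Rightarrow> 'v \<Rightarrow>\<^sub>0 nat" where
  "expo v \<equiv> single v 1"

lemma lookup_single_mult:
  fixes f :: "('v, 'k::field) mpoly"
  shows "lookup (single s c * f) (s + m) = c * lookup f m"
  by (simp add: lookup_mult lookup_single when_mult mult_when Sum_any_when_equal)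

lemma lookup_single_mult_eq_0:
  fixes f :: "('v, 'k::field) mpoly"
  assumes "\<And>m. t \<noteq> s + m"
  shows "lookup (single s c * f) t = 0"
  using assms by (simp add: lookup_mult lookup_single when_mult)

lemma lookup_Var_mult [simp]:
  "lookup (Var v * f) (expo v + m) = lookup f m"
  by (simp add: Var_def lookup_single_mult)

lemma lookup_Var_mult_eq_0 [simp]:
  assumes "lookup m v = 0"
  shows "lookup (Var v * f) m = 0"
proof -
  have "m \<noteq> expo v + t" for t using assms by (auto simp: lookup_add)
  then show ?thesis by (simp add: Var_def lookup_single_mult_eq_0)
qed

lemma expo_add_minus:
  assumes "lookup m v \<noteq> 0"
  shows "expo v + (m - expo v) = m"
  using assms by (intro poly_mapping_eqI) (auto simp: lookup_add lookup_minus lookup_single when_def)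

lemma mpoly_expand:
  fixes f :: "('v, 'k::field) mpoly"
  shows "f = (\<Sum>m\<in>keys f. single m (lookup f m))"
proof (rule poly_mapping_eqI)
  fix t
  show "lookup f t = lookup (\<Sum>m\<in>keys f. single m (lookup f m)) t"
    by (simp add: lookup_sum lookup_single when_def in_keys_iff)
qed

lemma mpoly_induct [case_names single add]:
  fixes f :: "('v, 'k::field) mpoly"
  assumes "\<And>m c. P (single m c)" "\<And>f g. P f \<Longrightarrow> P g \<Longrightarrow> P (f + g)"
  shows "P f"
proof -
  have "P (\<Sum>m\<in>M. single m (lookup f m))" if "finite M" for M
    using that
  proof (induction M)
    case empty
    show ?case using assms(1)[of 0 0] by simp
  next
    case (insert m M)
    then show ?case using assms by simp
  qed
  from this[OF finite_keys[of f]] show ?thesis by (simp flip: mpoly_expand)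
qed

text \<open>Derivations and test homomorphisms alike are prescribed on monomials and extended
  K-linearly in this way.\<close>

definition linear_ext :: "(('v \<Rightarrow>\<^sub>0 nat) \<Rightarrow> ('v, 'k::field) mpoly) \<Rightarrow> ('v, 'k) mpoly \<Rightarrow> ('v, 'k) mpoly" where
  "linear_ext \<tau> f = (\<Sum>m\<in>keys f. Const (lookup f m) * \<tau> m)"

lemma linear_ext_add: "linear_ext \<tau> (f + g) = linear_ext \<tau> f + linear_ext \<tau> g"
  unfolding linear_ext_def
  by (rule setsum_keys_plus_distrib) (simp_all add: Const_def single_add algebra_simps)

lemma linear_ext_single: "linear_ext \<tau> (single m c) = Const c * \<tau> m"
  by (cases "c = 0") (simp_all add: linear_ext_def Const_def)

lemma Const_mult_single [simp]: "Const c * single m d = single m (c * d)"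
  by (simp add: Const_def mult_single)

lemma Const_mult: "Const (c * d) = Const c * Const d"
  by (simp add: Const_def mult_single)

lemma linear_ext_Const_mult: "linear_ext \<tau> (Const c * f) = Const c * linear_ext \<tau> f"
proof (induction f rule: mpoly_induct)
  case (single m d)
  then show ?case by (simp add: linear_ext_single Const_mult mult.assoc)
next
  case (add f g)
  then show ?case by (simp add: distrib_left linear_ext_add)
qed

text \<open>The sum of the partial derivatives by x_v, each multiplied by \<open>g v\<close>. Where
  \<open>lookup m v = 0\<close>, the truncated subtraction does no harm, as the factor
  \<open>of_nat (lookup m v)\<close> is zero.\<close>

definition derivation :: "('v::finite \<Rightarrow> ('v, 'k::field) mpoly) \<Rightarrow> ('v, 'k) mpoly \<Rightarrow> ('v, 'k) mpoly" where
  "derivation g = linear_ext (\<lambda>m. \<Sum>v\<in>UNIV. of_nat (lookup m v) * (single (m - expo v) 1 * g v))"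

lemma derivation_Var: "derivation g (Var v) = g v"
proof -
  have "(\<Sum>u\<in>UNIV. of_nat (lookup (expo v) u) * (single (expo v - expo u) 1 * g u)) = 
      (\<Sum>u\<in>UNIV. if u = v then g v else 0)"
    by (intro sum.cong) (auto simp: lookup_single)
  then show ?thesis by (simp add: derivation_def Var_def linear_ext_single Const_def)
qed

lemma derivation_in_Der: "derivation g \<in> Der"
proof -
  define \<tau> where "\<tau> = (\<lambda>m. \<Sum>v\<in>UNIV. of_nat (lookup m v) * (single (m - expo v) 1 * g v))"
  \<comment> \<open>The Leibniz rule on monomials; additivity then extends it to one factor after
    the other.\<close>
  have prod: "\<tau> (m + n) = single m 1 * \<tau> n + single n 1 * \<tau> m" for m n
  proof -
    have "of_nat (lookup (m + n) v) * (single (m + n - expo v) 1 * g v)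
      = single m 1 * (of_nat (lookup n v) * (single (n - expo v) 1 * g v))
        + single n 1 * (of_nat (lookup m v) * (single (m - expo v) 1 * g v))" for v
    proof -
      have 1: "of_nat (lookup n v) * single (m + n - expo v) (1::'b)
          = of_nat (lookup n v) * (single m 1 * single (n - expo v) 1)" for m n :: "'a \<Rightarrow>\<^sub>0 nat"
      proof (cases "lookup n v = 0")
        case False
        then have "m + n - expo v = m + (n - expo v)"
          by (metis expo_add_minus add.left_commute add_diff_cancel_left')
        then show ?thesis by (simp add: mult_single)
      qed simp
      have "of_nat (lookup (m + n) v) * (single (m + n - expo v) 1 * g v)
        = (of_nat (lookup n v) * single (m + n - expo v) 1
          + of_nat (lookup m v) * single (n + m - expo v) 1) * g v"
        by (simp add: lookup_add algebra_simps)
      also have "\<dots> = (of_nat (lookup n v) * (single m 1 * single (n - expo v) 1)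
          + of_nat (lookup m v) * (single n 1 * single (m - expo v) 1)) * g v"
        by (simp only: 1)
      finally show ?thesis by (simp add: algebra_simps)
    qed
    then show ?thesis by (simp add: \<tau>_def sum_distrib_left flip: sum.distrib)
  qed
  have D: "derivation g = linear_ext \<tau>" by (simp add: derivation_def \<tau>_def)
  have leib1: "linear_ext \<tau> (single m c * f) = single m c * linear_ext \<tau> f + linear_ext \<tau> (single m c) * f" for m c f
  proof (induction f rule: mpoly_induct)
    case (single n d)
    have "linear_ext \<tau> (single m c * single n d) = Const c * Const d * (single m 1 * \<tau> n + single n 1 * \<tau> m)"
      by (simp add: mult_single linear_ext_single prod Const_mult)
    moreover have "single m c * linear_ext \<tau> (single n d) + linear_ext \<tau> (single m c) * single n d
       = (Const c * single m 1) * (Const d * \<tau> n) + (Const c * \<tau> m) * (Const d * single n 1)"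
      by (simp add: linear_ext_single)
    ultimately show ?case by (simp only: algebra_simps)
  next
    case (add f g)
    then show ?case by (simp add: algebra_simps linear_ext_add)
  qed
  have "linear_ext \<tau> (f * h) = f * linear_ext \<tau> h + linear_ext \<tau> f * h" for f h
  proof (induction f rule: mpoly_induct)
    case (single m c)
    show ?case by (rule leib1)
  next
    case (add f g)
    then show ?case by (simp add: algebra_simps linear_ext_add)
  qed
  then show ?thesis by (simp add: D Der_def linear_ext_add linear_ext_Const_mult)
qed

section \<open>Monomials of the edge ideal\<close>

definition covered :: "'v set set \<Rightarrow> ('v \<Rightarrow>\<^sub>0 nat) \<Rightarrow> bool" where
  "covered E m \<longleftrightarrow> (\<exists>u v. {u, v} \<in> E \<and> lookup m u \<noteq> 0 \<and> lookup m v \<noteq> 0)"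

lemma coveredI: "\<lbrakk>{u, v} \<in> E; lookup m u \<noteq> 0; lookup m v \<noteq> 0\<rbrakk> \<Longrightarrow> covered E m"
  unfolding covered_def by blast

lemma covered_add: "covered E m \<Longrightarrow> covered E (s + m)"
  by (force simp: covered_def lookup_add)

lemma poly_ring_idealI:
  fixes J :: "('v, 'k::field) mpoly set"
  assumes "0 \<in> J" "\<And>f g. f \<in> J \<Longrightarrow> g \<in> J \<Longrightarrow> f + g \<in> J" "\<And>s f. f \<in> J \<Longrightarrow> s * f \<in> J"
  shows "ideal J poly_ring"
proof (rule idealI)
  show R: "ring (poly_ring :: ('v, 'k) mpoly ring)" by (rule cring.axioms(1)[OF cring_poly_ring])
  then interpret R: ring "poly_ring :: ('v, 'k) mpoly ring" .
  show "subgroup J (add_monoid (poly_ring :: ('v, 'k) mpoly ring))"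
  proof (rule group.subgroupI[OF R.a_group])
    fix a assume a: "a \<in> J"
    have "\<ominus>\<^bsub>poly_ring\<^esub> a = - a"
      by (rule R.minus_equality) simp_all
    moreover have "- a \<in> J" using assms(3)[OF a, of "- 1"] by simp
    ultimately show "inv\<^bsub>add_monoid poly_ring\<^esub> a \<in> J" by (simp add: a_inv_def)
  qed (use assms in auto)
qed (use assms in \<open>auto simp: mult.commute\<close>)

lemma edge_ideal_0: "0 \<in> edge_ideal E"
  and edge_ideal_add: "f \<in> edge_ideal E \<Longrightarrow> g \<in> edge_ideal E \<Longrightarrow> f + g \<in> edge_ideal E"
  and edge_ideal_mult: "f \<in> edge_ideal E \<Longrightarrow> s * f \<in> edge_ideal E"
  for f :: "('v::finite, 'k::field) mpoly"
  using ideal_closed[OF ideal_edge_ideal] additive_subgroup.zero_closed[OF ideal.axioms(1)[OF ideal_edge_ideal]]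
  by auto

lemma edge_ideal_diff:
  fixes f :: "('v::finite, 'k::field) mpoly"
  assumes "f \<in> edge_ideal E" "g \<in> edge_ideal E" shows "f - g \<in> edge_ideal E"
  using edge_ideal_add[OF assms(1) edge_ideal_mult[OF assms(2), of "- 1"]] by simp

lemma edge_ideal_gen:
  assumes "{i, j} \<in> E"
  shows "Var i * Var j \<in> (edge_ideal E :: ('v::finite, 'k::field) mpoly set)"
proof -
  interpret R: cring "poly_ring :: ('v, 'k) mpoly ring" by (rule cring_poly_ring)
  have "{Var i * Var j | i j. {i, j} \<in> E} \<subseteq> (edge_ideal E :: ('v, 'k) mpoly set)"
    unfolding edge_ideal_def by (rule R.genideal_self) simp
  then show ?thesis using assms by blast
qed

lemma edge_ideal_induct:
  fixes J :: "('v::finite, 'k::field) mpoly set"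
  assumes "0 \<in> J" "\<And>f g. f \<in> J \<Longrightarrow> g \<in> J \<Longrightarrow> f + g \<in> J" "\<And>s f. f \<in> J \<Longrightarrow> s * f \<in> J"
    and "\<And>i j. {i, j} \<in> E \<Longrightarrow> Var i * Var j \<in> J"
  shows "edge_ideal E \<subseteq> J"
  unfolding edge_ideal_def
  by (rule ring.genideal_minimal[OF cring.axioms(1)[OF cring_poly_ring] poly_ring_idealI])
    (use assms in auto)

text \<open>Polynomials with only covered exponents form an ideal containing the generators;
  conversely, a covered monomial is a multiple of a generator.\<close>

lemma edge_ideal_iff:
  fixes f :: "('v::finite, 'k::field) mpoly"
  assumes "simple_graph E"
  shows "f \<in> edge_ideal E \<longleftrightarrow> (\<forall>m\<in>keys f. covered E m)"
proof
  have "edge_ideal E \<subseteq> {f :: ('v, 'k) mpoly. \<forall>m\<in>keys f. covered E m}"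
  proof (rule edge_ideal_induct)
    fix f g :: "('v, 'k) mpoly"
    assume "f \<in> {f. \<forall>m\<in>keys f. covered E m}" "g \<in> {f. \<forall>m\<in>keys f. covered E m}"
    then show "f + g \<in> {f. \<forall>m\<in>keys f. covered E m}" using Poly_Mapping.keys_add[of f g] by blast
  next
    fix s f :: "('v, 'k) mpoly" assume "f \<in> {f. \<forall>m\<in>keys f. covered E m}"
    then show "s * f \<in> {f. \<forall>m\<in>keys f. covered E m}"
      using keys_mult[of s f] covered_add by fastforce
  next
    fix i j assume "{i, j} \<in> E"
    then have "covered E (expo i + expo j)" by (rule coveredI) (simp_all add: lookup_add)
    then show "Var i * Var j \<in> {f :: ('v, 'k) mpoly. \<forall>m\<in>keys f. covered E m}"
      by (simp add: Var_def mult_single)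
  qed simp
  then show "f \<in> edge_ideal E \<Longrightarrow> \<forall>m\<in>keys f. covered E m" by blast
next
  assume cov: "\<forall>m\<in>keys f. covered E m"
  have single: "single m c \<in> edge_ideal E" if m: "covered E m" for m and c :: 'k
  proof -
    obtain u v where uv: "{u, v} \<in> E" "lookup m u \<noteq> 0" "lookup m v \<noteq> 0"
      using m by (auto simp: covered_def)
    then have "u \<noteq> v" using assms by (auto simp: simple_graph_def)
    then have "lookup (m - expo u) v \<noteq> 0" using uv(3) by (simp add: lookup_minus lookup_single)
    then have "m = expo u + (expo v + (m - expo u - expo v))"
      using uv(2) expo_add_minus by metis
    then have "single m c = single (m - expo u - expo v) c * (Var u * Var v)"
      by (metis (no_types, lifting) Var_def add.commute add.left_commute mult.right_neutral mult_single)
    then show ?thesis using edge_ideal_mult[OF edge_ideal_gen[OF uv(1)]] by simp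
  qed
  have "(\<Sum>m\<in>M. single m (lookup f m)) \<in> edge_ideal E" if "finite M" "M \<subseteq> keys f" for M
    using that by (induction M rule: finite_induct) (simp_all add: edge_ideal_0 edge_ideal_add single cov)
  from this[OF finite_keys subset_refl] show "f \<in> edge_ideal E" by (simp flip: mpoly_expand)
qed

lemma edge_ideal_lookup:
  fixes f :: "('v::finite, 'k::field) mpoly"
  assumes "simple_graph E" "f \<in> edge_ideal E" "\<not> covered E m"
  shows "lookup f m = 0"
  using assms edge_ideal_iff[OF assms(1), of f] by (auto simp: in_keys_iff)

subsection \<open>Rigidity of edge ideals\<close>

lemma carrier_Mod_trivial_iff:
  fixes G (structure)
  assumes "group G" "subgroup H G"
  shows "carrier (G Mod H) = {\<one>\<^bsub>G Mod H\<^esub>} \<longleftrightarrow> carrier G \<subseteq> H"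
proof -
  interpret group G by fact
  have Mod: "carrier (G Mod H) = rcosets H" "\<one>\<^bsub>G Mod H\<^esub> = H" by (simp_all add: FactGroup_def)
  show ?thesis unfolding Mod
  proof
    assume *: "rcosets H = {H}"
    show "carrier G \<subseteq> H"
    proof
      fix x assume x: "x \<in> carrier G"
      then have "H #> x = H" using * by (auto simp: RCOSETS_def)
      then show "x \<in> H" using rcos_self[OF x assms(2)] by simp
    qed
  next
    assume "carrier G \<subseteq> H"
    then have "H #> x = H" if "x \<in> carrier G" for x
      using that coset_join2[OF that assms(2)] by blast
    then show "rcosets H = {H}" by (auto simp: RCOSETS_def)
  qed
qed

text \<open>Describes a homomorphism from \<open>I\<close> to S/I by representatives in S: all
  conditions are congruences modulo \<open>I\<close>, and values outside \<open>I\<close> are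
  unconstrained.\<close>

definition hom_mod :: "('v::finite, 'k::field) mpoly set \<Rightarrow> (('v, 'k) mpoly \<Rightarrow> ('v, 'k) mpoly) \<Rightarrow> bool" where
  "hom_mod I \<phi> \<longleftrightarrow> (\<forall>f\<in>I. \<forall>g\<in>I. \<phi> (f + g) - (\<phi> f + \<phi> g) \<in> I) \<and> (\<forall>s. \<forall>f\<in>I. \<phi> (s * f) - s * \<phi> f \<in> I)"

text \<open>\<open>T1\<close> is trivial when \<open>delta_star\<close> is onto, and every
  coset-valued homomorphism lifts to representatives.\<close>

lemma rigid_iff:
  fixes E :: "'v::finite set set"
  defines "I \<equiv> edge_ideal E :: ('v, 'k::field) mpoly set"
  shows "rigid TYPE('k) E \<longleftrightarrow> (\<forall>\<phi>. hom_mod I \<phi> \<longrightarrow> (\<exists>D\<in>Der. \<forall>f\<in>I. \<phi> f - D f \<in> I))"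
proof -
  have I: "ideal I poly_ring" unfolding I_def by (rule ideal_edge_ideal)
  interpret R: cring "poly_ring :: ('v, 'k) mpoly ring" by (rule cring_poly_ring)
  define p where "p = (\<lambda>s. I +>\<^bsub>poly_ring\<^esub> s)"
  have p: "p s \<in> carrier (poly_ring Quot I)" "p (s + t) = p s \<oplus>\<^bsub>poly_ring Quot I\<^esub> p t"
    "p (s * t) = p s \<otimes>\<^bsub>poly_ring Quot I\<^esub> p t" for s t
    using ideal.rcos_ring_hom[OF I] by (auto simp: p_def ring_hom_def)
  have p_eq: "p s = p t \<longleftrightarrow> s - t \<in> I" for s t
  proof -
    have "\<ominus>\<^bsub>poly_ring\<^esub> t = - t" by (rule R.minus_equality) simp_all
    then have "s \<ominus>\<^bsub>poly_ring\<^esub> t = s - t" by (simp add: a_minus_def)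
    then show ?thesis using R.quotient_eq_iff_same_a_r_cos[OF I, of s t] by (simp add: p_def)
  qed
  have p_surj: "\<exists>s. x = p s" if "x \<in> carrier (poly_ring Quot I)" for x
    using that by (auto simp: FactRing_def A_RCOSETS_def' p_def)
  have hom: "(\<lambda>f\<in>I. p (\<phi> f)) \<in> carrier (Hom_quot I) \<longleftrightarrow> hom_mod I \<phi>" for \<phi>
    by (auto simp: Hom_quot_def hom_mod_def ideal_closed[OF I] p p_def[symmetric] simp flip: p_eq)
  have lift: "\<exists>\<phi>. x = (\<lambda>f\<in>I. p (\<phi> f))" if "x \<in> carrier (Hom_quot I)" for x
  proof -
    have x: "x \<in> I \<rightarrow>\<^sub>E carrier (poly_ring Quot I)" using that by (simp add: Hom_quot_def)
    then have "\<forall>f\<in>I. \<exists>s. x f = p s" using p_surj by blast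
    then obtain \<phi> where "\<forall>f\<in>I. x f = p (\<phi> f)" by metis
    with x show ?thesis by (intro exI[of _ \<phi>] extensionalityI[of _ I]) (auto simp: PiE_def)
  qed
  have delta: "(\<lambda>f\<in>I. p (\<phi> f)) = delta_star I D \<longleftrightarrow> (\<forall>f\<in>I. \<phi> f - D f \<in> I)" for \<phi> D
    by (auto simp: delta_star_def restrict_def fun_eq_iff p_def[symmetric] simp flip: p_eq)
  have "rigid TYPE('k) E \<longleftrightarrow> carrier (Hom_quot I) \<subseteq> delta_star I ` Der"
    unfolding rigid_def T1_def I_def[symmetric]
    by (rule carrier_Mod_trivial_iff[OF comm_group.axioms(2)[OF comm_group_Hom_quot[OF I]] subgroup_delta_star[OF I]])
  also have "\<dots> \<longleftrightarrow> (\<forall>\<phi>. hom_mod I \<phi> \<longrightarrow> (\<exists>D\<in>Der. \<forall>f\<in>I. \<phi> f - D f \<in> I))"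
  proof
    assume sub: "carrier (Hom_quot I) \<subseteq> delta_star I ` Der"
    show "\<forall>\<phi>. hom_mod I \<phi> \<longrightarrow> (\<exists>D\<in>Der. \<forall>f\<in>I. \<phi> f - D f \<in> I)"
    proof (intro allI impI)
      fix \<phi> assume "hom_mod I \<phi>"
      then have "(\<lambda>f\<in>I. p (\<phi> f)) \<in> delta_star I ` Der" using hom sub by blast
      then show "\<exists>D\<in>Der. \<forall>f\<in>I. \<phi> f - D f \<in> I" using delta by blast
    qed
  next
    assume R: "\<forall>\<phi>. hom_mod I \<phi> \<longrightarrow> (\<exists>D\<in>Der. \<forall>f\<in>I. \<phi> f - D f \<in> I)"
    show "carrier (Hom_quot I) \<subseteq> delta_star I ` Der"
    proof
      fix x assume x: "x \<in> carrier (Hom_quot I)"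
      then obtain \<phi> where \<phi>: "x = (\<lambda>f\<in>I. p (\<phi> f))" using lift by blast
      then have "hom_mod I \<phi>" using hom x by blast
      then show "x \<in> delta_star I ` Der" using R delta \<phi> by blast
    qed
  qed
  finally show ?thesis .
qed

section \<open>Sufficiency of the branch and triangle conditions\<close>

lemma covered_free_nbr:
  assumes "nbrs E k = {i}" "k \<noteq> i" "lookup m i = 0" "\<not> covered E m"
  shows "\<not> covered E (expo k + m)"
proof
  assume "covered E (expo k + m)"
  then obtain u v where uv: "{u, v} \<in> E" "lookup (expo k + m) u \<noteq> 0" "lookup (expo k + m) v \<noteq> 0"
    by (auto simp: covered_def)
  have i0: "lookup (expo k + m) i = 0" using assms by (simp add: lookup_add lookup_single)
  \<comment> \<open>The only edge at \<open>k\<close> leads to \<open>i\<close>, whose variable is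
    absent, so the covering edge avoids \<open>k\<close> and already covers
    \<open>m\<close>.\<close>
  have "w = i" if "{k, w} \<in> E" for w using assms(1) that by (auto simp: nbrs_def)
  then have "u \<noteq> k" "v \<noteq> k" using uv i0 by (metis insert_commute)+
  then have "covered E m" using uv by (auto simp: lookup_add lookup_single intro: coveredI)
  with assms(4) show False by blast
qed

text \<open>A covering edge is not \<open>{j, k}\<close>, so it avoids \<open>j\<close> or
  \<open>k\<close> and already covers one of the two given monomials.\<close>

lemma covered_pair:
  assumes "simple_graph E" "{j, k} \<notin> E" "j \<noteq> k" "\<not> covered E (expo j + m)" "\<not> covered E (expo k + m)"
  shows "\<not> covered E (expo k + (expo j + m))"
proof
  assume "covered E (expo k + (expo j + m))"
  then obtain u v where uv: "{u, v} \<in> E" "lookup (expo k + (expo j + m)) u \<noteq> 0"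
    "lookup (expo k + (expo j + m)) v \<noteq> 0"
    by (auto simp: covered_def)
  have "u \<noteq> v" using uv(1) assms(1) by (auto simp: simple_graph_def)
  have "{u, v} \<noteq> {j, k}" using uv(1) assms(2) by auto
  with \<open>u \<noteq> v\<close> \<open>j \<noteq> k\<close> consider "u \<noteq> k" "v \<noteq> k" | "u \<noteq> j" "v \<noteq> j" by blast
  then show False
  proof cases
    case 1
    then have "covered E (expo j + m)" using uv by (auto simp: lookup_add lookup_single intro: coveredI)
    with assms(4) show False by blast
  next
    case 2
    then have "covered E (expo k + m)" using uv by (auto simp: lookup_add lookup_single intro: coveredI)
    with assms(5) show False by blast
  qed
qed

text \<open>\<open>br\<close> annihilates the coefficients of the image of x_i x_j at monomials
  outside the ideal that contain neither variable; \<open>tri\<close> lets adjacent neighbours of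
  \<open>i\<close> be compared.\<close>

lemma rigidI:
  fixes E :: "'v::finite set set"
  assumes G: "simple_graph E"
    and br: "\<And>i j. {i, j} \<in> E \<Longrightarrow> \<exists>k. k \<noteq> i \<and> k \<noteq> j \<and> (nbrs E k = {i} \<or> nbrs E k = {j})"
    and tri: "\<And>i j k. \<lbrakk>j \<in> nbrs E i; k \<in> nbrs E i; k \<in> nbrs E j\<rbrakk> \<Longrightarrow> \<exists>p. nbrs E p = {i}"
  shows "rigid TYPE('k::field) E"
  unfolding rigid_iff
proof (intro allI impI)
  let ?I = "edge_ideal E :: ('v, 'k) mpoly set"
  fix \<phi> :: "('v, 'k) mpoly \<Rightarrow> ('v, 'k) mpoly"
  assume "hom_mod ?I \<phi>"
  then have \<phi>_add: "\<And>f g. f \<in> ?I \<Longrightarrow> g \<in> ?I \<Longrightarrow> \<phi> (f + g) - (\<phi> f + \<phi> g) \<in> ?I"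
    and \<phi>_mult: "\<And>s f. f \<in> ?I \<Longrightarrow> \<phi> (s * f) - s * \<phi> f \<in> ?I"
    by (auto simp: hom_mod_def)
  define h where "h i j = \<phi> (Var i * Var j)" for i j
  have h_sym: "h i j = h j i" for i j by (simp add: h_def mult.commute)
  have irr: "\<And>v. v \<notin> nbrs E v" using nbrs_irrefl[OF G] .
  have gen: "Var i * Var j \<in> ?I" if "j \<in> nbrs E i" for i j
    using edge_ideal_gen that by (auto simp: nbrs_def)
  \<comment> \<open>Both products represent the image of x_i x_j x_k.\<close>
  have syzygy: "Var k * h i j - Var j * h i k \<in> ?I" if "j \<in> nbrs E i" "k \<in> nbrs E i" for i j k
  proof -
    have "(\<phi> (Var j * (Var i * Var k)) - Var j * h i k) - (\<phi> (Var k * (Var i * Var j)) - Var k * h i j) \<in> ?I"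
      unfolding h_def using that by (intro edge_ideal_diff \<phi>_mult gen)
    moreover have "Var j * (Var i * Var k) = Var k * (Var i * Var j)" by (simp add: algebra_simps)
    moreover have "a - x - (a - y) = y - x" for a x y :: "('v, 'k) mpoly" by simp
    ultimately show ?thesis by metis
  qed
  have syz_lookup: "lookup (Var k * h i j) m = lookup (Var j * h i k) m"
    if "j \<in> nbrs E i" "k \<in> nbrs E i" "\<not> covered E m" for i j k m
    using edge_ideal_lookup[OF G syzygy[OF that(1,2)] that(3)] by (simp add: lookup_minus)
  have swap: "lookup (h i j) (expo j + m) = lookup (h i k) (expo k + m)"
    if "j \<in> nbrs E i" "k \<in> nbrs E i" "k \<notin> nbrs E j" "j \<noteq> k"
      "\<not> covered E (expo j + m)" "\<not> covered E (expo k + m)" for i j k m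
  proof -
    have "\<not> covered E (expo k + (expo j + m))"
      using covered_pair[OF G _ that(4-6)] that(3) by (simp add: nbrs_def)
    then have "lookup (Var k * h i j) (expo k + (expo j + m)) = lookup (Var j * h i k) (expo k + (expo j + m))"
      by (rule syz_lookup[OF that(1,2)])
    also have "\<dots> = lookup (Var j * h i k) (expo j + (expo k + m))" by (simp only: add.left_commute)
    finally show ?thesis by (simp only: lookup_Var_mult)
  qed
  \<comment> \<open>The syzygy of \<open>j\<close> and \<open>k\<close> is read at x_k m: x_j does
    not divide this monomial, so the right side contributes 0.\<close>
  have vanish1: "lookup (h i j) m = 0"
    if "j \<in> nbrs E i" "lookup m i = 0" "lookup m j = 0" "\<not> covered E m" "nbrs E k = {i}" "k \<noteq> j" for i j k m
  proof -
    have ki: "k \<in> nbrs E i" using nbrs_symD[of i E k] that(5) by simp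
    then have "k \<noteq> i" using irr by blast
    then have "\<not> covered E (expo k + m)" by (rule covered_free_nbr[OF that(5) _ that(2,4)])
    then have "lookup (Var k * h i j) (expo k + m) = lookup (Var j * h i k) (expo k + m)"
      by (rule syz_lookup[OF that(1) ki])
    moreover have "lookup (expo k + m) j = 0" using that by (simp add: lookup_add lookup_single)
    ultimately show ?thesis by (simp only: lookup_Var_mult lookup_Var_mult_eq_0)
  qed
  have vanish: "lookup (h i j) m = 0"
    if "j \<in> nbrs E i" "lookup m i = 0" "lookup m j = 0" "\<not> covered E m" for i j m
  proof -
    have "i \<in> nbrs E j" by (rule nbrs_symD[OF that(1)])
    moreover have "{i, j} \<in> E" using that(1) by (simp add: nbrs_def)
    then obtain k where "k \<noteq> i" "k \<noteq> j" "nbrs E k = {i} \<or> nbrs E k = {j}"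
      using br by blast
    ultimately show ?thesis using vanish1[OF that, of k] vanish1[OF _ that(3,2,4), of k] h_sym[of i j] by auto
  qed
  have well_def: "lookup (h i j) (expo j + m) = lookup (h i k) (expo k + m)"
    if jk: "j \<in> nbrs E i" "k \<in> nbrs E i" and m: "lookup m i = 0"
      and cov: "\<not> covered E (expo j + m)" "\<not> covered E (expo k + m)" for i j k m
  proof (cases "k \<in> nbrs E j")
    case False
    then show ?thesis using swap jk cov by (cases "j = k") blast+
  next
    case True
    \<comment> \<open>Adjacent \<open>j\<close> and \<open>k\<close> cannot be compared directly, as
      x_j x_k lies in the ideal; the free neighbour \<open>p\<close> of \<open>i\<close> is adjacent
      to neither and mediates.\<close>
    then obtain p where p: "nbrs E p = {i}" using tri jk by blast
    then have pi: "p \<in> nbrs E i" using nbrs_symD[of i E p] by simp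
    then have "p \<noteq> i" using irr by blast
    then have pc: "\<not> covered E (expo p + m)"
      using covered_free_nbr[OF p _ m] cov covered_add by blast
    have "j \<noteq> i" "k \<noteq> i" using jk irr by blast+
    then have np: "j \<notin> nbrs E p" "k \<notin> nbrs E p" using p by auto
    have "j \<in> nbrs E k" by (rule nbrs_symD[OF True])
    then have "p \<noteq> j" "p \<noteq> k" using np True by blast+
    then show ?thesis using swap[OF pi jk(1) np(1) _ pc cov(1)] swap[OF pi jk(2) np(2) _ pc cov(2)] by simp
  qed
  \<comment> \<open>Where \<open>x\<^sub>i\<close> divides \<open>m\<close> the coefficient may be set to \<open>0\<close>, since there \<open>x\<^sub>j m\<close> lies in the ideal for all neighbours \<open>j\<close> of \<open>i\<close>.\<close>
  define c where "c i m = (if lookup m i = 0 \<and> (\<exists>j\<in>nbrs E i. \<not> covered E (expo j + m))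
      then (let j = SOME j. j \<in> nbrs E i \<and> \<not> covered E (expo j + m) in lookup (h i j) (expo j + m)) else 0)" for i m
  have c_eq: "c i m = lookup (h i j) (expo j + m)"
    if "j \<in> nbrs E i" "\<not> covered E (expo j + m)" "lookup m i = 0" for i j m
  proof -
    let ?j = "SOME j. j \<in> nbrs E i \<and> \<not> covered E (expo j + m)"
    have "?j \<in> nbrs E i \<and> \<not> covered E (expo ?j + m)" by (rule someI[of _ j]) (use that in simp)
    then have "lookup (h i ?j) (expo ?j + m) = lookup (h i j) (expo j + m)"
      using well_def[OF _ that(1,3) _ that(2)] by simp
    moreover have "\<exists>j\<in>nbrs E i. \<not> covered E (expo j + m)" using that by blast
    ultimately show ?thesis using that(3) by (simp add: c_def Let_def)
  qed
  \<comment> \<open>Each nonzero \<open>c i m\<close> is the coefficient of some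
    \<open>h i j\<close> at \<open>expo j + m\<close>, with only finitely many choices of
    \<open>j\<close>.\<close>
  have fin: "finite {m. c i m \<noteq> 0}" for i
  proof (rule finite_subset)
    show "{m. c i m \<noteq> 0} \<subseteq> (\<Union>j. (\<lambda>m. expo j + m) -` keys (h i j))"
      unfolding c_def Let_def by (auto simp: in_keys_iff simp del: One_nat_def split: if_splits)
    show "finite (\<Union>j. (\<lambda>m. expo j + m) -` keys (h i j))"
      by (intro finite_UN_I finite_vimageI) (auto simp: inj_on_def)
  qed
  define g where "g i = Abs_poly_mapping (c i)" for i
  have g_lookup: "lookup (g i) m = c i m" for i m
    using fin by (simp add: g_def)
  define D where "D = derivation g"
  have D: "D \<in> Der" unfolding D_def by (rule derivation_in_Der)
  then have D_add: "D (f + f') = D f + D f'" and D_mult: "D (f * f') = f * D f' + D f * f'" for f f'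
    by (auto simp: Der_def)
  have D_Var: "D (Var v) = g v" for v by (simp add: D_def derivation_Var)
  have D_gen: "D (Var i * Var j) = Var i * g j + Var j * g i" for i j
    by (simp add: D_mult D_Var mult.commute)
  \<comment> \<open>Outside the ideal x_i or x_j is missing. By symmetry let it be x_i; then the
    summand with \<open>g j\<close> contributes nothing.\<close>
  have half: "lookup (h i j) m = lookup (Var i * g j + Var j * g i) m"
    if ij: "j \<in> nbrs E i" and m: "\<not> covered E m" "lookup m i = 0" for i j m
  proof (cases "lookup m j = 0")
    case True
    then show ?thesis using vanish[OF ij m(2) True m(1)] m(2) by (simp add: lookup_add)
  next
    case False
    then obtain n where n: "m = expo j + n" using expo_add_minus by metis
    then have "lookup n i = 0" using m(2) by (simp add: lookup_add)
    then have "c i n = lookup (h i j) m" using c_eq[OF ij] m(1) n by simp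
    moreover have "lookup (Var j * g i) m = c i n" unfolding n lookup_Var_mult by (rule g_lookup)
    ultimately show ?thesis
      using lookup_Var_mult_eq_0[OF m(2), of "g j"] by (simp only: lookup_add add_0_left)
  qed
  have on_gens: "\<phi> (Var i * Var j) - D (Var i * Var j) \<in> ?I" if ij: "j \<in> nbrs E i" for i j
    unfolding edge_ideal_iff[OF G]
  proof (rule ballI, rule ccontr)
    fix m assume m: "m \<in> keys (\<phi> (Var i * Var j) - D (Var i * Var j))" "\<not> covered E m"
    have ji: "i \<in> nbrs E j" using nbrs_symD[OF ij] .
    have "lookup m i = 0 \<or> lookup m j = 0" using coveredI[of i j E m] m(2) ij by (auto simp: nbrs_def)
    then have "lookup (h i j) m = lookup (Var i * g j + Var j * g i) m"
      using half[OF ij m(2)] half[OF ji m(2)] by (auto simp: h_sym add.commute)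
    then have "lookup (\<phi> (Var i * Var j) - D (Var i * Var j)) m = 0"
      by (simp add: lookup_minus D_gen h_def)
    with m(1) show False by (simp add: in_keys_iff)
  qed
  \<comment> \<open>The elements of the ideal on which \<open>\<phi>\<close> and \<open>D\<close>
    agree modulo it form an ideal themselves, so the generators suffice.\<close>
  have "?I \<subseteq> {f \<in> ?I. \<phi> f - D f \<in> ?I}"
  proof (rule edge_ideal_induct)
    have "D 0 = 0" using D_add[of 0 0] by simp
    moreover have "\<phi> 0 \<in> ?I" using \<phi>_mult[OF edge_ideal_0, of 0] by simp
    ultimately show "0 \<in> {f \<in> ?I. \<phi> f - D f \<in> ?I}" by (simp add: edge_ideal_0)
  next
    fix f f' assume a: "f \<in> {f \<in> ?I. \<phi> f - D f \<in> ?I}" "f' \<in> {f \<in> ?I. \<phi> f - D f \<in> ?I}"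
    have "\<phi> (f + f') - (\<phi> f + \<phi> f') + ((\<phi> f - D f) + (\<phi> f' - D f')) \<in> ?I"
      using a by (intro edge_ideal_add \<phi>_add) auto
    then show "f + f' \<in> {f \<in> ?I. \<phi> f - D f \<in> ?I}"
      using a by (simp add: D_add edge_ideal_add algebra_simps)
  next
    fix s f assume a: "f \<in> {f \<in> ?I. \<phi> f - D f \<in> ?I}"
    have "(\<phi> (s * f) - s * \<phi> f) + s * (\<phi> f - D f) - D s * f \<in> ?I"
      using a by (blast intro: edge_ideal_diff[OF edge_ideal_add[OF \<phi>_mult edge_ideal_mult] edge_ideal_mult])
    moreover have "(\<phi> (s * f) - s * \<phi> f) + s * (\<phi> f - D f) - D s * f = \<phi> (s * f) - D (s * f)"
      by (simp add: D_mult algebra_simps)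
    ultimately show "s * f \<in> {f \<in> ?I. \<phi> f - D f \<in> ?I}" using a by (simp add: edge_ideal_mult)
  next
    fix i j assume "{i, j} \<in> E"
    then have "j \<in> nbrs E i" by (simp add: nbrs_def)
    then show "Var i * Var j \<in> {f \<in> ?I. \<phi> f - D f \<in> ?I}" using on_gens gen by blast
  qed
  with D show "\<exists>D\<in>Der. \<forall>f\<in>?I. \<phi> f - D f \<in> ?I" by blast
qed

section \<open>Test homomorphisms and necessity\<close>

lemma hom_mod_linear_ext:
  fixes E :: "'v::finite set set" and \<tau> :: "('v \<Rightarrow>\<^sub>0 nat) \<Rightarrow> ('v, 'k::field) mpoly"
  assumes G: "simple_graph E"
    and \<tau>: "\<And>s m. covered E m \<Longrightarrow> \<tau> (s + m) - single s 1 * \<tau> m \<in> edge_ideal E"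
  shows "hom_mod (edge_ideal E) (linear_ext \<tau>)"
proof -
  let ?I = "edge_ideal E :: ('v, 'k) mpoly set" and ?L = "linear_ext \<tau>"
  \<comment> \<open>\<open>1\<close> passes from monomial multipliers to arbitrary \<open>s\<close>,
    and \<open>2\<close> from covered monomials to their sums, which exhaust the ideal by
    \<open>edge_ideal_iff\<close>.\<close>
  have 1: "?L (s * single m d) - s * ?L (single m d) \<in> ?I" if m: "covered E m" for s m d
  proof (induction s rule: mpoly_induct)
    case (single t c)
    have "Const (c * d) * (\<tau> (t + m) - single t 1 * \<tau> m) \<in> ?I" by (intro edge_ideal_mult \<tau> m)
    moreover have "Const (c * d) * (single t 1 * \<tau> m) = single t c * (Const d * \<tau> m)"
    proof -
      have "single t c = Const c * single t 1" by simp
      then show ?thesis by (simp only: Const_mult ac_simps)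
    qed
    ultimately show ?case by (simp add: mult_single linear_ext_single right_diff_distrib)
  next
    case (add f g)
    then have "(?L (f * single m d) - f * ?L (single m d)) + (?L (g * single m d) - g * ?L (single m d)) \<in> ?I"
      by (rule edge_ideal_add)
    then show ?case by (simp add: linear_ext_add algebra_simps)
  qed
  have 2: "?L (s * (\<Sum>m\<in>M. single m (a m))) - s * ?L (\<Sum>m\<in>M. single m (a m)) \<in> ?I"
    if "finite M" "\<forall>m\<in>M. covered E m" for s M a
    using that
  proof (induction M)
    case empty
    show ?case by (simp add: linear_ext_def edge_ideal_0)
  next
    case (insert m M)
    let ?S = "\<Sum>m\<in>M. single m (a m)"
    have "(?L (s * single m (a m)) - s * ?L (single m (a m))) + (?L (s * ?S) - s * ?L ?S) \<in> ?I"
      using insert by (intro edge_ideal_add 1) auto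
    then show ?case using insert(1,2) by (simp add: linear_ext_add algebra_simps)
  qed
  have "?L (s * f) - s * ?L f \<in> ?I" if "f \<in> ?I" for s f
    using 2[OF finite_keys, of f s "lookup f"] that edge_ideal_iff[OF G, of f]
    by (simp flip: mpoly_expand)
  then show ?thesis by (auto simp: hom_mod_def linear_ext_add edge_ideal_0)
qed

definition indicator_exp :: "'v::finite set \<Rightarrow> 'v \<Rightarrow>\<^sub>0 nat" where
  "indicator_exp A = (\<Sum>v\<in>A. expo v)"

lemma lookup_indicator_exp [simp]: "lookup (indicator_exp A) v = (if v \<in> A then 1 else 0)"
  by (simp add: indicator_exp_def lookup_sum lookup_single when_def)

lemma not_covered_indicator: "indep E A \<Longrightarrow> \<not> covered E (indicator_exp A)"
  by (auto simp: indep_def covered_def split: if_splits)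

lemma Var_mult_Var: "Var i * Var j = single (expo i + expo j) 1"
  by (simp add: Var_def mult_single)

text \<open>At monomials outside the ideal a congruence becomes an equality of coefficients;
  \<open>g\<close> gives the images of the variables under the derivation supplied by
  rigidity.\<close>

lemma rigid_derivation:
  fixes E :: "'v::finite set set" and \<tau> :: "('v \<Rightarrow>\<^sub>0 nat) \<Rightarrow> ('v, 'k::field) mpoly"
  assumes G: "simple_graph E" and R: "rigid TYPE('k) E"
    and \<tau>: "\<And>s m. covered E m \<Longrightarrow> \<tau> (s + m) - single s 1 * \<tau> m \<in> edge_ideal E"
  obtains g :: "'v \<Rightarrow> ('v, 'k) mpoly" where
    "\<And>i j m. {i, j} \<in> E \<Longrightarrow> \<not> covered E m \<Longrightarrow>
      lookup (\<tau> (expo i + expo j)) m = lookup (Var i * g j) m + lookup (Var j * g i) m"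
proof -
  have "hom_mod (edge_ideal E) (linear_ext \<tau>)" by (rule hom_mod_linear_ext[OF G \<tau>])
  then obtain D where D: "D \<in> Der" "\<And>f. f \<in> edge_ideal E \<Longrightarrow> linear_ext \<tau> f - D f \<in> edge_ideal E"
    using R unfolding rigid_iff by blast
  show thesis
  proof (rule that[of "\<lambda>v. D (Var v)"])
    fix i j m assume ij: "{i, j} \<in> E" and m: "\<not> covered E m"
    have "lookup (linear_ext \<tau> (Var i * Var j) - D (Var i * Var j)) m = 0"
      using edge_ideal_lookup[OF G D(2)[OF edge_ideal_gen[OF ij]] m] .
    moreover have "linear_ext \<tau> (Var i * Var j) = \<tau> (expo i + expo j)"
      by (simp add: Var_mult_Var linear_ext_single Const_def)
    moreover have "D (Var i * Var j) = Var i * D (Var j) + Var j * D (Var i)"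
      using D(1) by (simp add: Der_def mult.commute)
    ultimately show "lookup (\<tau> (expo i + expo j)) m = lookup (Var i * D (Var j)) m + lookup (Var j * D (Var i)) m"
      by (simp add: lookup_minus lookup_add)
  qed
qed

lemma single_in_edge_ideal:
  assumes "simple_graph E" "covered E m"
  shows "single m c \<in> (edge_ideal E :: ('v::finite, 'k::field) mpoly set)"
  using assms by (simp add: edge_ideal_iff)

text \<open>The test homomorphism has degree \<open>a - x\<^sub>i\<close> with \<open>a\<close> the indicator of \<open>A\<close>: it sends \<open>x\<^sub>i x\<^sub>j\<close>
  to \<open>x\<^sup>a x\<^sub>j\<close> and the other generators to \<open>0\<close>, whereas a derivation has the same coefficient in
  this degree on all \<open>x\<^sub>i x\<^sub>k\<close>.\<close>

lemma rigid_no_dominating: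
  fixes E :: "'v::finite set set"
  assumes G: "simple_graph E" and R: "rigid TYPE('k::field) E"
    and A: "indep E A" "i \<notin> A"
    and j: "j \<in> nbrs E i" "nbrs E j \<inter> A = {}"
    and dom: "\<And>k. \<lbrakk>k \<in> nbrs E i; nbrs E k \<inter> A = {}; k \<noteq> j\<rbrakk> \<Longrightarrow> k \<in> nbrs E j"
    and k: "k \<in> nbrs E i" "nbrs E k \<inter> A = {}"
  shows "k = j"
proof (rule ccontr)
  assume "k \<noteq> j"
  have irr: "\<And>v. v \<notin> nbrs E v" using nbrs_irrefl[OF G] .
  have ne: "j \<noteq> i" "k \<noteq> i" using j k irr by blast+
  let ?a = "indicator_exp A"
  define \<tau> :: "('v \<Rightarrow>\<^sub>0 nat) \<Rightarrow> ('v, 'k) mpoly"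
    where "\<tau> m = (if lookup m i \<noteq> 0 \<and> lookup m j \<noteq> 0 then single (m - expo i + ?a) 1 else 0)" for m
  have \<tau>: "\<tau> (s + m) - single s 1 * \<tau> m \<in> edge_ideal E" if m: "covered E m" for s m
  proof (cases "lookup m i \<noteq> 0 \<and> lookup m j \<noteq> 0")
    case True
    then have "s + m - expo i = s + (m - expo i)"
      by (intro poly_mapping_eqI) (auto simp: lookup_add lookup_minus lookup_single when_def)
    then show ?thesis using True by (simp add: \<tau>_def lookup_add mult_single add.assoc edge_ideal_0)
  next
    case no: False
    show ?thesis
    proof (cases "lookup (s + m) i \<noteq> 0 \<and> lookup (s + m) j \<noteq> 0")
      case False
      then show ?thesis using no by (auto simp: \<tau>_def edge_ideal_0)
    next
      case True
      \<comment> \<open>Here x^s supplies a missing variable, so \<open>?n\<close> has to be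
        covered. An edge avoiding \<open>i\<close> persists. An edge \<open>{i, v}\<close> is
        replaced by \<open>{j, v}\<close> if \<open>v\<close> has no neighbour in \<open>A\<close>,
        and otherwise by an edge from \<open>v\<close> into \<open>A\<close>.\<close>
      let ?n = "s + m - expo i + ?a"
      have n: "lookup ?n w = lookup s w + lookup m w + (if w \<in> A then 1 else 0)" if "w \<noteq> i" for w
        using that by (simp add: lookup_add lookup_minus lookup_single)
      have at_i: "covered E ?n" if v: "v \<in> nbrs E i" "lookup m i \<noteq> 0" "lookup m v \<noteq> 0" for v
      proof -
        have vi: "v \<noteq> i" "v \<noteq> j" using v irr no by blast+
        show ?thesis
        proof (cases "nbrs E v \<inter> A = {}")
          case True': True
          have "v \<in> nbrs E j" using dom v(1) True' vi by blast
          then show ?thesis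
            using True v vi n ne by (intro coveredI[of j v]) (auto simp: nbrs_def lookup_add)
        next
          case False
          then obtain w where "w \<in> nbrs E v" "w \<in> A" by blast
          moreover have "w \<noteq> i" using \<open>w \<in> A\<close> A(2) by blast
          ultimately show ?thesis
            using v vi n by (intro coveredI[of v w]) (auto simp: nbrs_def)
        qed
      qed
      obtain u v where uv: "{u, v} \<in> E" "lookup m u \<noteq> 0" "lookup m v \<noteq> 0"
        using m by (auto simp: covered_def)
      have "covered E ?n"
      proof (cases "u = i \<or> v = i")
        case True
        then show ?thesis using at_i[of u] at_i[of v] uv by (auto simp: nbrs_def insert_commute)
      next
        case False
        then show ?thesis using uv n by (intro coveredI[of u v]) auto
      qed
      then show ?thesis using True no by (auto simp: \<tau>_def intro: single_in_edge_ideal[OF G])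
    qed
  qed
  obtain g where g: "\<And>i j m. {i, j} \<in> E \<Longrightarrow> \<not> covered E m \<Longrightarrow>
      lookup (\<tau> (expo i + expo j)) m = lookup (Var i * g j) m + lookup (Var j * g i) m"
    using rigid_derivation[OF G R \<tau>] by blast
  \<comment> \<open>The monomial x_l x^a lies outside the ideal, as \<open>insert l A\<close> is
    independent, and x_i does not divide it; so only the summand with \<open>g i\<close>
    contributes.\<close>
  have coeff: "lookup (\<tau> (expo i + expo l)) (expo l + ?a) = lookup (g i) ?a"
    if l: "l \<in> nbrs E i" "nbrs E l \<inter> A = {}" for l
  proof -
    have li: "l \<noteq> i" using l irr by blast
    have "\<not> covered E (expo l + ?a)"
    proof
      assume "covered E (expo l + ?a)"
      then obtain u v where uv: "{u, v} \<in> E" "lookup (expo l + ?a) u \<noteq> 0" "lookup (expo l + ?a) v \<noteq> 0"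
        by (auto simp: covered_def)
      then have "u \<in> insert l A" "v \<in> insert l A"
        by (auto simp: lookup_add lookup_single when_def split: if_splits)
      moreover have "u \<noteq> v" using uv(1) G by (auto simp: simple_graph_def)
      ultimately show False
        using l(2) A(1) uv(1) by (auto simp: indep_def nbrs_def insert_commute)
    qed
    moreover have "lookup (expo l + ?a) i = 0" using li A(2) by (simp add: lookup_add lookup_single)
    ultimately show ?thesis
      using g[of i l "expo l + ?a"] l(1) by (simp add: nbrs_def del: One_nat_def)
  qed
  \<comment> \<open>The coefficient of \<open>g i\<close> at x^a would be 1 according to
    \<open>j\<close> and 0 according to \<open>k\<close>.\<close>
  have "expo i + expo j - expo i + ?a = expo j + ?a" by simp
  then have "lookup (\<tau> (expo i + expo j)) (expo j + ?a) = 1"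
    by (simp add: \<tau>_def lookup_add)
  moreover have "\<tau> (expo i + expo k) = 0"
    using ne \<open>k \<noteq> j\<close> by (simp add: \<tau>_def lookup_add lookup_single)
  ultimately show False using coeff[OF j] coeff[OF k] by simp
qed

text \<open>Here the test homomorphism sends \<open>x\<^sub>i x\<^sub>j\<close> to \<open>x\<^sup>a\<close>, and derivations vanish in its degree.\<close>

lemma rigid_no_isolated_edge:
  fixes E :: "'v::finite set set"
  assumes G: "simple_graph E" and R: "rigid TYPE('k::field) E"
    and A: "indep E A" "i \<notin> A" "j \<notin> A" and ij: "j \<in> nbrs E i"
  shows "\<exists>k\<in>(nbrs E i \<union> nbrs E j) - {i, j}. nbrs E k \<inter> A = {}"
proof (rule ccontr)
  assume W: "\<not> ?thesis"
  have ne: "i \<noteq> j" using ij nbrs_irrefl[OF G] by blast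
  let ?a = "indicator_exp A"
  define \<tau> :: "('v \<Rightarrow>\<^sub>0 nat) \<Rightarrow> ('v, 'k) mpoly"
    where "\<tau> m = (if lookup m i \<noteq> 0 \<and> lookup m j \<noteq> 0 then single (m - expo i - expo j + ?a) 1 else 0)" for m
  have \<tau>: "\<tau> (s + m) - single s 1 * \<tau> m \<in> edge_ideal E" if m: "covered E m" for s m
  proof (cases "lookup m i \<noteq> 0 \<and> lookup m j \<noteq> 0")
    case True
    then have "s + m - expo i - expo j = s + (m - expo i - expo j)"
      using ne by (intro poly_mapping_eqI) (auto simp: lookup_add lookup_minus lookup_single when_def)
    then show ?thesis using True by (simp add: \<tau>_def lookup_add mult_single add.assoc edge_ideal_0)
  next
    case no: False
    show ?thesis
    proof (cases "lookup (s + m) i \<noteq> 0 \<and> lookup (s + m) j \<noteq> 0")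
      case False
      then show ?thesis using no by (auto simp: \<tau>_def edge_ideal_0)
    next
      case True
      let ?n = "s + m - expo i - expo j + ?a"
      have n: "lookup ?n w = lookup s w + lookup m w + (if w \<in> A then 1 else 0)" if "w \<noteq> i" "w \<noteq> j" for w
        using that by (simp add: lookup_add lookup_minus lookup_single)
      \<comment> \<open>Dividing by x_i x_j may destroy the edge from \<open>v\<close> to
        \<open>i\<close> or \<open>j\<close>, but by \<open>W\<close> the vertex \<open>v\<close>
        also has a neighbour in \<open>A\<close>, whose variable divides x^a.\<close>
      have at_ij: "covered E ?n" if v: "v \<in> nbrs E i \<union> nbrs E j" "v \<notin> {i, j}" "lookup m v \<noteq> 0" for v
      proof -
        obtain w where "w \<in> nbrs E v" "w \<in> A" using W v by blast
        moreover have "w \<noteq> i" "w \<noteq> j" using \<open>w \<in> A\<close> A by blast+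
        ultimately show ?thesis
          using v n by (intro coveredI[of v w]) (auto simp: nbrs_def)
      qed
      obtain u v where uv: "{u, v} \<in> E" "lookup m u \<noteq> 0" "lookup m v \<noteq> 0"
        using m by (auto simp: covered_def)
      have "u \<noteq> v" using uv(1) G by (auto simp: simple_graph_def)
      then have "\<not> (u \<in> {i, j} \<and> v \<in> {i, j})" using no uv by auto
      then consider "u \<in> {i, j}" "v \<notin> {i, j}" | "v \<in> {i, j}" "u \<notin> {i, j}" | "u \<notin> {i, j}" "v \<notin> {i, j}"
        by blast
      then have "covered E ?n"
      proof cases
        case 1
        then show ?thesis using at_ij[of v] uv by (auto simp: nbrs_def)
      next
        case 2
        then show ?thesis using at_ij[of u] uv by (auto simp: nbrs_def insert_commute)
      next
        case 3
        then show ?thesis using uv n by (intro coveredI[of u v]) auto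
      qed
      then show ?thesis using True no by (auto simp: \<tau>_def intro: single_in_edge_ideal[OF G])
    qed
  qed
  obtain g where g: "\<And>i j m. {i, j} \<in> E \<Longrightarrow> \<not> covered E m \<Longrightarrow>
      lookup (\<tau> (expo i + expo j)) m = lookup (Var i * g j) m + lookup (Var j * g i) m"
    using rigid_derivation[OF G R \<tau>] by blast
  have "expo i + expo j - expo i - expo j + ?a = ?a" by simp
  then have "lookup (\<tau> (expo i + expo j)) ?a = 1"
    by (simp add: \<tau>_def lookup_add)
  \<comment> \<open>Neither x_i nor x_j divides x^a, so both summands vanish there.\<close>
  moreover have "lookup (\<tau> (expo i + expo j)) ?a = 0"
    using g[of i j ?a] ij not_covered_indicator[OF A(1)] A by (simp add: nbrs_def)
  ultimately show False by simp
qed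

theorem theorem3p10:
  fixes E :: "'v::finite set set"
  assumes "simple_graph E"
    and "\<nexists>vs. induced_cycle E vs \<and> length vs \<in> {4, 5, 6}"
  shows "rigid TYPE('k::field) E \<longleftrightarrow>
    (\<forall>e\<in>E. branch E e) \<and>
    (\<forall>vs. cycle E vs \<and> length vs = 3 \<longrightarrow> (\<forall>v\<in>set vs. \<exists>e. leaf E e \<and> v \<in> e))"
proof -
  note G = assms(1)
  have edges: "(\<forall>e\<in>E. branch E e) \<longleftrightarrow> (\<forall>i j. {i, j} \<in> E \<longrightarrow> branch E {i, j})"
    using G unfolding simple_graph_def card_2_iff by metis
  show ?thesis
    unfolding triangle_leaf_iff[OF G] edges
  proof
    assume R: "rigid TYPE('k) E"
    interpret inseparable_graph E
      by (intro inseparable_graph.intro assms rigid_no_dominating[OF G R] rigid_no_isolated_edge[OF G R])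
    show "(\<forall>i j. {i, j} \<in> E \<longrightarrow> branch E {i, j}) \<and>
      (\<forall>i j k. j \<in> nbrs E i \<and> k \<in> nbrs E i \<and> k \<in> nbrs E j \<longrightarrow> (\<exists>p. nbrs E p = {i}))"
      using triangle_has_leaf edge_has_branch branch_iff[OF G] by (auto simp: nbrs_def)
  next
    assume "(\<forall>i j. {i, j} \<in> E \<longrightarrow> branch E {i, j}) \<and>
      (\<forall>i j k. j \<in> nbrs E i \<and> k \<in> nbrs E i \<and> k \<in> nbrs E j \<longrightarrow> (\<exists>p. nbrs E p = {i}))"
    then show "rigid TYPE('k) E"
      using branch_iff[OF G] by (intro rigidI[OF G]) blast+
  qed
qed

end
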